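(* Let $d\ge 2$ and let $\mathcal{D}(p)$ be a $d$-dimensional diamond framework with complete set of edge representatives $p=(p_0,\dots,p_d)$, labelled so that the squared lengths $s_i=\langle p_i,p_i\rangle$ satisfy $0<s_0\le s_1\le\cdots\le s_d$. Then the deformation space of $\mathcal{D}(p)$ is a manifold of dimension $\binom{d+1}{2}-1$ and can be described as the quotient $$\Big(\prod_{i=0}^d S^{d-1}_{\sqrt{s_i}}\setminus\{q: V(q)=0\}\Big)\big/ O(d).$$ Moreover, the equation $$\det\begin{pmatrix} s_0&\alpha&\cdots&\alpha\\ \alpha&s_1&\cdots&\alpha\\ \vdots&\vdots&\ddots&\vdots\\ \alpha&\alpha&\cdots&s_d\end{pmatrix}=0$$ in the unknown $\alpha$ (the matrix has diagonal entries $s_0,\dots,s_d$ and all off-diagonal entries equal to $\alpha$) has a unique negative root $\alpha_-$, and the squared volume $V(q)^2$ of a fundamental parallelepiped (unit cell) has, on the deformation space, a maximum corresponding to $\alpha_-$, that is, at the configuration $q=(q_0,\dots,q_d)$ with $\langle q_i,q_j\rangle=\alpha_-$ for all $i\ne j$ (and $\langle q_i,q_i\rangle=s_i$).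
   Context: $S^{d-1}_r$ denotes the sphere of radius $r$ centered at the origin in $\mathbb{R}^d$. For $q=(q_0,\dots,q_d)\in(\mathbb{R}^d)^{d+1}$ put $V(q)=\det[\,q_1-q_0\ \cdots\ q_d-q_0\,]$, the oriented volume of the parallelepiped spanned by $q_i-q_0$, $i=1,\dots,d$. Diamond framework: given $p=(p_0,\dots,p_d)$ with $p_i\in\mathbb{R}^d\setminus\{0\}$ and $V(p)\ne0$, let $\Lambda$ be the rank $d$ lattice generated by $p_i-p_0$, $i=1,\dots,d$. The diamond (diamantine) framework $\mathcal{D}(p)$ is the $\Lambda$-periodic bar-and-joint framework whose vertices are the $\Lambda$-translates of the origin $O$ and of the endpoint of $p_0$, and whose edges (bars) are the $\Lambda$-translates of the $d+1$ segments from $O$ to the endpoints of $p_0,\dots,p_d$. The vectors $p_0,\dots,p_d$ are a complete set of edge representatives, and the parallelepiped spanned by $p_i-p_0$, $i=1,\dots,d$, is the unit cell. Deformations are new placements of the vertices which preserve all edge lengths and remain periodic with respect to the same abstract periodicity group (the lattice of translations representing this group may vary), considered up to isometries of $\mathbb{R}^d$. Concretely, the deformation space of $\mathcal{D}(p)$ is the quotient, by the natural (diagonal) action of $SO(d)$, of the connected component containing $p$ of $\prod_{i=0}^d S^{d-1}_{\sqrt{s_i}}\setminus\{q:V(q)=0\}$. In the quotient by $O(d)$ in the claim, $O(d)$ also acts diagonally; $V(q)^2$ is $O(d)$-invariant. *)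

theory Defs
  imports "HOL-Analysis.Analysis" "HOL-Library.Option_ord"
begin

text \<open>
  A configuration \<open>q = (q\<^sub>0, \<dots>, q\<^sub>d)\<close> of \<open>d + 1\<close> vectors in \<open>\<real>\<^sup>d\<close>, \<open>d = CARD('n)\<close>, is indexed by
  \<open>'n option\<close>: \<open>None\<close> is the label \<open>0\<close> and the \<open>Some k\<close> are the labels \<open>1, \<dots>, d\<close>.
  A linear order on \<open>'n\<close> makes \<open>'n option\<close> the chain \<open>0 < 1 < \<dots> < d\<close> with least element \<open>None\<close>.
\<close>

type_synonym 'n config = "((real, 'n) vec, 'n option) vec"

definition oriented_volume :: "'n::finite config \<Rightarrow> real" where
  "oriented_volume q = det (\<chi> i j. (q $ Some j - q $ None) $ i)"

definition sq_length :: "'n::finite config \<Rightarrow> 'n option \<Rightarrow> real" where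
  "sq_length q i = q $ i \<bullet> q $ i"

definition diamond_framework :: "'n::finite config \<Rightarrow> bool" where
  "diamond_framework p \<longleftrightarrow> (\<forall>i. p $ i \<noteq> 0) \<and> oriented_volume p \<noteq> 0"

definition config_space :: "('n::finite option \<Rightarrow> real) \<Rightarrow> 'n config set" where
  "config_space s = {q. \<forall>i. q $ i \<in> sphere 0 (sqrt (s i))} - {q. oriented_volume q = 0}"

definition component_of_framework :: "'n::finite config \<Rightarrow> 'n config set" where
  "component_of_framework p = connected_component_set (config_space (sq_length p)) p"

definition orthogonal_group :: "(real ^ 'n::finite ^ 'n) set" where
  "orthogonal_group = {A. orthogonal_matrix A}"

definition special_orthogonal_group :: "(real ^ 'n::finite ^ 'n) set" where
  "special_orthogonal_group = {A. rotation_matrix A}"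

definition orbit :: "(real ^ 'n::finite ^ 'n) set \<Rightarrow> 'n config \<Rightarrow> 'n config set" where
  "orbit G q = (\<lambda>A. \<chi> i. A *v q $ i) ` G"

definition orbit_space :: "(real ^ 'n::finite ^ 'n) set \<Rightarrow> 'n config set \<Rightarrow> 'n config set topology"
  where "orbit_space G S =
    topology (\<lambda>\<U>. \<U> \<subseteq> orbit G ` S \<and> openin (top_of_set S) {q \<in> S. orbit G q \<in> \<U>})"

lemma openin_orbit_space:
  "openin (orbit_space G S) \<U> \<longleftrightarrow>
    \<U> \<subseteq> orbit G ` S \<and> openin (top_of_set S) {q \<in> S. orbit G q \<in> \<U>}"
proof -
  let ?L = "\<lambda>\<U>. \<U> \<subseteq> orbit G ` S \<and> openin (top_of_set S) {q \<in> S. orbit G q \<in> \<U>}"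
  have "istopology ?L"
    unfolding istopology_def
  proof (intro conjI allI impI)
    fix \<U> \<V> assume "?L \<U>" "?L \<V>"
    moreover have "{q \<in> S. orbit G q \<in> \<U> \<inter> \<V>} = {q \<in> S. orbit G q \<in> \<U>} \<inter> {q \<in> S. orbit G q \<in> \<V>}"
      by blast
    ultimately show "\<U> \<inter> \<V> \<subseteq> orbit G ` S" "openin (top_of_set S) {q \<in> S. orbit G q \<in> \<U> \<inter> \<V>}"
      by auto
  next
    fix \<K> assume "\<forall>\<U>\<in>\<K>. ?L \<U>"
    moreover have "{q \<in> S. orbit G q \<in> \<Union>\<K>} = (\<Union>\<U>\<in>\<K>. {q \<in> S. orbit G q \<in> \<U>})"
      by blast
    ultimately show "\<Union>\<K> \<subseteq> orbit G ` S" "openin (top_of_set S) {q \<in> S. orbit G q \<in> \<Union>\<K>}"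
      by (auto intro: openin_Union)
  qed
  then show ?thesis
    unfolding orbit_space_def by (simp add: topology_inverse')
qed

lemma topspace_orbit_space [simp]: "topspace (orbit_space G S) = orbit G ` S"
proof -
  have "{q \<in> S. orbit G q \<in> orbit G ` S} = S"
    by blast
  then have "openin (orbit_space G S) (orbit G ` S)"
    by (simp add: openin_orbit_space)
  then show ?thesis
    by (meson openin_orbit_space openin_subset openin_topspace subset_antisym)
qed

lemma quotient_map_orbit_space: "quotient_map (top_of_set S) (orbit_space G S) (orbit G)"
  by (auto simp: quotient_map_def openin_orbit_space)

definition deformation_space :: "'n::finite config \<Rightarrow> 'n config set topology" where
  "deformation_space p = orbit_space special_orthogonal_group (component_of_framework p)"

definition manifold_of_dim :: "nat \<Rightarrow> 'a topology \<Rightarrow> bool" where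
  "manifold_of_dim n X \<longleftrightarrow> Hausdorff_space X \<and> second_countable X \<and>
    (\<forall>x\<in>topspace X. \<exists>U V. openin X U \<and> x \<in> U \<and> openin (Euclidean_space n) V \<and>
       subtopology X U homeomorphic_space subtopology (Euclidean_space n) V)"

definition equi_gram_matrix :: "('i::finite \<Rightarrow> real) \<Rightarrow> real \<Rightarrow> real ^ 'i ^ 'i" where
  "equi_gram_matrix s \<alpha> = (\<chi> i j. if i = j then s i else \<alpha>)"

end

theory Submission
  imports Defs
begin

text \<open>
  For each vertex the volume \<open>V\<close> is an affine function of that vertex alone, and the caps that \<open>V > 0\<close>
  cuts out of its sphere are connected. Hence, at a maximum of \<open>V\<^sup>2\<close> over a connected component of the
  configuration space, every vertex sits at the top of its cap. This forces all scalar products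
  \<open>q\<^sub>i \<bullet> q\<^sub>j\<close> to agree, and the barycentric coordinates of the origin to be less than \<open>1\<close>, which makes the
  common value negative. A kernel vector of the Gram matrix shows that it is the unique negative root,
  so a component is determined by the sign of \<open>V\<close>, because \<open>SO(d)\<close> is connected.

  The Gram matrix identifies the orbit spaces with the part \<open>V\<^sup>2 \<noteq> 0\<close> of the relative boundary of the convex
  body of positive semidefinite matrices with diagonal \<open>s\<close>. That boundary is a sphere of dimension
  \<open>(d + 1 choose 2) - 1\<close>, and removing from it a Gram matrix of rank one leaves a Euclidean space.
\<close>

section \<open>Oriented volume and Gram matrices\<close>

text \<open>The negative root is not extracted from the determinant. It appears as the common scalar
  product at a volume maximum, where the Gram matrix is singular because d + 1 vectors in dimension
  d are dependent. A maximum exists in every component: the closure of the component is compact, and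
  V = 0 at the limit points that are lost. Orbit spaces carry the quotient topology, so a continuous
  bijection onto Gram matrices is not enough. The Gram map is shown to be closed, which rests on
  compactness of the product of spheres and on V^2 being a polynomial in the Gram matrix: a
  configuration sharing its Gram matrix with one of nonzero volume has nonzero volume too. Passing
  from one component modulo SO(d) to the whole space modulo O(d) takes a single reflection, which
  reverses the sign of V and keeps the Gram matrix.\<close>

lemma sum_option: "(\<Sum>i\<in>UNIV. f i) = f None + (\<Sum>j\<in>UNIV. f (Some j))"
  for f :: "'n::finite option \<Rightarrow> 'a::comm_monoid_add"
  by (simp add: UNIV_option_conv sum.reindex)

definition replace_vertex :: "'n::finite config \<Rightarrow> 'n option \<Rightarrow> real ^ 'n \<Rightarrow> 'n config" where
  "replace_vertex q i x = (\<chi> j. if j = i then x else q $ j)"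

lemma replace_vertex_nth [simp]: "replace_vertex q i x $ j = (if j = i then x else q $ j)"
  by (simp add: replace_vertex_def)

lemma replace_vertex_same [simp]: "replace_vertex q i (q $ i) = q"
  by (simp add: vec_eq_iff)

lemma oriented_volume_rows: "oriented_volume q = det (\<chi> j. q $ Some j - q $ None)"
proof -
  have "(\<chi> i j. (q $ Some j - q $ None) $ i) = transpose (\<chi> j. q $ Some j - q $ None)"
    by (simp add: transpose_def vec_eq_iff)
  then show ?thesis
    by (simp add: oriented_volume_def)
qed

text \<open>A repeated vertex shows up as a zero row if \<open>None\<close> is involved, and as two
  equal rows otherwise.\<close>

lemma oriented_volume_eq_vertices:
  assumes "q $ i = q $ j" "i \<noteq> j"
  shows "oriented_volume q = 0"
proof -
  have *: "oriented_volume q = 0" if "q $ Some k = q $ None" for k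
    unfolding oriented_volume_rows
    by (rule det_zero_row(1)[of k]) (use that in \<open>simp add: row_def vec_eq_iff\<close>)
  show ?thesis
  proof (cases i)
    case None
    with assms * show ?thesis by (cases j) auto
  next
    case (Some k)
    show ?thesis
    proof (cases j)
      case None
      with Some assms * show ?thesis by auto
    next
      case (Some l)
      have "det (\<chi> j. q $ Some j - q $ None) = 0"
        by (rule det_identical_rows[of k l]) (use assms \<open>i = Some k\<close> Some in \<open>auto simp: row_def vec_eq_iff\<close>)
      then show ?thesis
        by (simp add: oriented_volume_rows)
    qed
  qed
qed

lemma oriented_volume_matrix_mult:
  "oriented_volume (\<chi> i. A *v q $ i) = det A * oriented_volume q"
proof -
  have "(\<chi> i j. ((\<chi> i. A *v q $ i) $ Some j - (\<chi> i. A *v q $ i) $ None) $ i)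
      = A ** (\<chi> i j. (q $ Some j - q $ None) $ i)"
    by (simp add: vec_eq_iff matrix_matrix_mult_def matrix_vector_mult_def
        right_diff_distrib sum_subtractf)
  then show ?thesis
    by (simp add: oriented_volume_def det_mul)
qed

text \<open>The determinant is linear in row k; the representing vector is the adjoint of this
  functional evaluated at 1.\<close>

lemma det_row_functional:
  fixes v :: "'n::finite \<Rightarrow> real ^ 'n"
  obtains c where "\<And>x. det (\<chi> j. if j = k then x else v j) = c \<bullet> x"
proof
  let ?f = "\<lambda>x. det (\<chi> j. if j = k then x else v j)"
  have "linear ?f"
  proof (rule linearI)
    show "?f (x + y) = ?f x + ?f y" for x y
      using det_row_add[of k "\<lambda>_. x" "\<lambda>_. y" v] by simp
    show "?f (r *\<^sub>R x) = r *\<^sub>R ?f x" for r x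
      using det_row_mul[of k r "\<lambda>_. x" v] by (simp add: scalar_mult_eq_scaleR cong: if_cong)
  qed
  from adjoint_works[OF this, of _ 1] show "?f x = adjoint ?f 1 \<bullet> x" for x
    by (simp add: inner_commute)
qed

text \<open>A vertex other than \<open>None\<close> occurs in one row only. The vertex
  \<open>None\<close> occurs in all rows, so for it the base vertex is first changed to an arbitrary
  \<open>Some k\<close>.\<close>

lemma oriented_volume_affine:
  fixes q :: "'n::finite config"
  obtains c b where "\<And>x. oriented_volume (replace_vertex q i x) = c \<bullet> x + b"
proof (cases i)
  case (Some k)
  obtain c where c: "\<And>x. det (\<chi> j. if j = k then x else q $ Some j - q $ None) = c \<bullet> x"
    using det_row_functional[of k "\<lambda>j. q $ Some j - q $ None"] by blast
  have "oriented_volume (replace_vertex q i x) = c \<bullet> x + - (c \<bullet> q $ None)" for x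
  proof -
    have "oriented_volume (replace_vertex q i x)
        = det (\<chi> j. if j = k then x - q $ None else q $ Some j - q $ None)"
      unfolding oriented_volume_rows by (rule arg_cong[where f=det]) (simp add: vec_eq_iff Some)
    then show ?thesis
      by (simp add: c inner_diff_right)
  qed
  then show ?thesis
    by (rule that)
next
  case None
  fix k :: 'n
  obtain c where c: "\<And>x. det (\<chi> j. if j = k then x else q $ Some j - q $ Some k) = c \<bullet> x"
    using det_row_functional[of k "\<lambda>j. q $ Some j - q $ Some k"] by blast
  \<comment> \<open>Multiplication by \<open>P\<close> subtracts row \<open>k\<close> from all the others, which leaves \<open>x\<close> in a single row.\<close>
  define P :: "real^'n^'n" where
    "P = (\<chi> j l. (if l = j then 1 else 0) - (if l = k then if j = k then 0 else 1 else 0))"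
  \<comment> \<open>\<open>P'\<close> adds back what \<open>P\<close> subtracts. Being an inverse,
    it yields \<open>det P \<noteq> 0\<close> without evaluating that determinant.\<close>
  define P' :: "real^'n^'n" where
    "P' = (\<chi> j l. (if l = j then 1 else 0) + (if l = k then if j = k then 0 else 1 else 0))"
  have if_mult: "(if b then (1::real) else 0) * z = (if b then z else 0)" for b z
    by simp
  have "P ** P' = mat 1"
    by (simp add: P_def P'_def matrix_matrix_mult_def mat_def vec_eq_iff left_diff_distrib
        sum_subtractf if_mult if_distribR cong: if_cong)
  then have "det P * det P' = 1"
    by (metis det_I det_mul)
  then have nz: "det P \<noteq> 0"
    by auto
  have "oriented_volume (replace_vertex q i x) = (- (1 / det P) *\<^sub>R c) \<bullet> x + (c \<bullet> q $ Some k) / det P" for x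
  proof -
    have "P ** (\<chi> j. q $ Some j - x) = (\<chi> j. if j = k then q $ Some k - x else q $ Some j - q $ Some k)"
      by (simp add: P_def matrix_matrix_mult_def vec_eq_iff left_diff_distrib
        sum_subtractf if_mult if_distribR cong: if_cong)
    then have "det P * det (\<chi> j. q $ Some j - x) = c \<bullet> (q $ Some k - x)"
      by (simp only: det_mul[symmetric] c)
    moreover have "oriented_volume (replace_vertex q i x) = det (\<chi> j. q $ Some j - x)"
      by (simp add: oriented_volume_rows None)
    ultimately have "oriented_volume (replace_vertex q i x) = (c \<bullet> (q $ Some k - x)) / det P"
      using nz by (simp add: eq_divide_eq mult.commute)
    then show ?thesis
      by (simp add: inner_diff_right diff_divide_distrib)
  qed
  then show ?thesis
    by (rule that)
qed

text \<open>Nonzero volume makes the edge vectors at vertex \<open>None\<close> a basis. The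
  coordinates of \<open>- q $ None\<close> in it are the weights of the other vertices, and
  \<open>None\<close> receives the complement to 1.\<close>

lemma barycentric_origin:
  fixes q :: "'n::finite config"
  assumes "oriented_volume q \<noteq> 0"
  obtains w where "(\<Sum>i\<in>UNIV. w i) = 1" "(\<Sum>i\<in>UNIV. w i *\<^sub>R q $ i) = 0"
proof -
  let ?M = "(\<chi> i j. (q $ Some j - q $ None) $ i) :: real^'n^'n"
  have "invertible ?M"
    using assms by (simp add: invertible_det_nz oriented_volume_def)
  then obtain c where c: "?M *v c = - q $ None"
    by (metis invertible_def matrix_vector_mul_assoc matrix_vector_mul_lid)
  define w where "w i = (case i of None \<Rightarrow> 1 - (\<Sum>j\<in>UNIV. c $ j) | Some j \<Rightarrow> c $ j)" for i
  have "(\<Sum>j\<in>UNIV. c $ j *\<^sub>R (q $ Some j - q $ None)) = - q $ None"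
    unfolding c[symmetric] by (simp add: vec_eq_iff matrix_vector_mult_def mult.commute)
  then have "(\<Sum>j\<in>UNIV. c $ j *\<^sub>R q $ Some j) - (\<Sum>j\<in>UNIV. c $ j) *\<^sub>R q $ None = - q $ None"
    by (simp add: scaleR_diff_right sum_subtractf scaleR_left.sum)
  then have "(\<Sum>i\<in>UNIV. w i *\<^sub>R q $ i) = 0"
    by (simp add: sum_option w_def scaleR_diff_left algebra_simps)
  moreover have "(\<Sum>i\<in>UNIV. w i) = 1"
    by (simp add: sum_option w_def)
  ultimately show ?thesis
    using that by blast
qed

text \<open>As a function of vertex i, the volume is affine and vanishes at every other vertex, so
  only the i-th weight survives when it is evaluated at the barycentric expression of the
  origin.\<close>

lemma oriented_volume_barycentric:
  assumes "(\<Sum>i\<in>UNIV. w i) = 1" "(\<Sum>i\<in>UNIV. w i *\<^sub>R q $ i) = 0"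
  shows "oriented_volume (replace_vertex q i 0) = w i * oriented_volume q"
proof -
  obtain c b where c: "\<And>x. oriented_volume (replace_vertex q i x) = c \<bullet> x + b"
    using oriented_volume_affine[of q i] by blast
  have z: "c \<bullet> q $ j + b = 0" if "j \<noteq> i" for j
    using oriented_volume_eq_vertices[of "replace_vertex q i (q $ j)" i j] that by (simp flip: c)
  have "oriented_volume (replace_vertex q i 0) = c \<bullet> (\<Sum>j\<in>UNIV. w j *\<^sub>R q $ j) + (\<Sum>j\<in>UNIV. w j) * b"
    by (simp add: c assms)
  also have "\<dots> = (\<Sum>j\<in>UNIV. w j * (c \<bullet> q $ j + b))"
    by (simp add: inner_sum_right sum_distrib_right sum.distrib distrib_left)
  also have "\<dots> = (\<Sum>j\<in>UNIV. if j = i then w j * oriented_volume q else 0)"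
    by (rule sum.cong) (use z c[of "q $ i"] in auto)
  finally show ?thesis
    by simp
qed

definition gram_matrix :: "'n::finite config \<Rightarrow> real ^ 'n option ^ 'n option" where
  "gram_matrix q = (\<chi> i j. q $ i \<bullet> q $ j)"

lemma gram_matrix_nth [simp]: "gram_matrix q $ i $ j = q $ i \<bullet> q $ j"
  by (simp add: gram_matrix_def)

text \<open>For the Gram matrix of a configuration these are the scalar products of the edge vectors
  at vertex \<open>None\<close>. The formula is stated for arbitrary G because it is also applied
  before any configuration realizing G is known.\<close>

definition edge_gram :: "real ^ 'n::finite option ^ 'n option \<Rightarrow> real ^ 'n ^ 'n" where
  "edge_gram G = (\<chi> j k. G $ Some j $ Some k - G $ Some j $ None - G $ None $ Some k + G $ None $ None)"

lemma edge_gram_gram_matrix: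
  "edge_gram (gram_matrix q) $ j $ k = (q $ Some j - q $ None) \<bullet> (q $ Some k - q $ None)"
  by (simp add: edge_gram_def inner_diff_left inner_diff_right inner_commute)

text \<open>The condition V = 0 and the squared volume thereby become functions of the Gram matrix
  alone, which lets both descend to orbits.\<close>

lemma det_edge_gram: "det (edge_gram (gram_matrix q)) = (oriented_volume q)\<^sup>2"
proof -
  let ?R = "(\<chi> j. q $ Some j - q $ None) :: real^'a^'a"
  have "edge_gram (gram_matrix q) = ?R ** transpose ?R"
    by (simp add: vec_eq_iff edge_gram_gram_matrix matrix_matrix_mult_def transpose_def inner_vec_def)
  then show ?thesis
    by (simp add: det_mul oriented_volume_rows power2_eq_square)
qed

lemma quadratic_form_gram:
  "x \<bullet> (gram_matrix q *v x) = (norm (\<Sum>i\<in>UNIV. x $ i *\<^sub>R q $ i))\<^sup>2"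
proof -
  have "x \<bullet> (gram_matrix q *v x) = (\<Sum>i\<in>UNIV. x $ i * (\<Sum>j\<in>UNIV. (q $ i \<bullet> q $ j) * x $ j))"
    by (simp add: inner_vec_def[where 'b="'a option"] matrix_vector_mult_def)
  also have "\<dots> = (\<Sum>i\<in>UNIV. x $ i *\<^sub>R q $ i) \<bullet> (\<Sum>j\<in>UNIV. x $ j *\<^sub>R q $ j)"
    by (simp add: inner_sum_left inner_sum_right sum_distrib_left mult_ac inner_commute)
  finally show ?thesis
    by (simp add: power2_norm_eq_inner)
qed

lemma continuous_on_det [continuous_intros]:
  fixes f :: "'a::topological_space \<Rightarrow> real ^ 'n::finite ^ 'n"
  assumes "continuous_on S f"
  shows "continuous_on S (\<lambda>x. det (f x))"
  unfolding det_def using assms by (intro continuous_intros)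

lemma continuous_on_oriented_volume [continuous_intros]:
  assumes "continuous_on S f"
  shows "continuous_on S (\<lambda>x. oriented_volume (f x))"
  unfolding oriented_volume_def using assms by (intro continuous_intros)

lemma continuous_on_gram_matrix: "continuous_on S gram_matrix"
  unfolding gram_matrix_def by (intro continuous_intros)

lemma continuous_on_det_edge_gram: "continuous_on S (\<lambda>G. det (edge_gram G))"
  unfolding edge_gram_def by (intro continuous_intros)

section \<open>Configurations of maximal volume\<close>

text \<open>Moving up a meridian towards the pole in direction c increases
  \<open>c \<bullet> z\<close>, so the half-space is never left. There is no unique meridian when x
  is parallel to c; if x is the lower pole, the whole sphere is used instead, and its connectedness
  requires dimension at least 2.\<close>

lemma connected_in_sphere_cap:
  fixes c x :: "'a::euclidean_space"
  assumes dim: "2 \<le> DIM('a)" and x: "norm x = r" and pos: "0 < c \<bullet> x + b" and c: "c \<noteq> 0"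
  obtains S where "connected S" "x \<in> S" "(r / norm c) *\<^sub>R c \<in> S"
    "\<forall>z\<in>S. norm z = r \<and> 0 < c \<bullet> z + b"
proof -
  define e where "e = c /\<^sub>R norm c"
  define h where "h = e \<bullet> x"
  define v where "v = x - h *\<^sub>R e"
  have e: "e \<bullet> e = 1" and ce: "c = norm c *\<^sub>R e"
    using c by (simp_all add: e_def dot_square_norm power2_eq_square)
  have goal_top: "(r / norm c) *\<^sub>R c = r *\<^sub>R e"
    by (simp add: e_def divide_inverse)
  have xx: "x \<bullet> x = r\<^sup>2"
    using x by (simp add: power2_norm_eq_inner[symmetric])
  have ev: "e \<bullet> v = 0" "v \<bullet> e = 0"
    by (simp_all add: v_def inner_diff_right inner_diff_left e h_def inner_commute)
  have vv: "v \<bullet> v = r\<^sup>2 - h\<^sup>2"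
    by (simp add: v_def inner_diff_left inner_diff_right e xx h_def inner_commute power2_eq_square)
  have cz: "c \<bullet> z = norm c * (e \<bullet> z)" for z
    by (subst ce) simp
  have r0: "0 \<le> r"
    using x norm_ge_zero by blast
  show ?thesis
  proof (cases "v = 0")
    case True
    then have xh: "x = h *\<^sub>R e" and "h\<^sup>2 = r\<^sup>2"
      using vv by (simp_all add: v_def)
    then consider "h = r" | "h = - r"
      by (metis power2_eq_iff)
    then show ?thesis
    proof cases
      case 1
      show ?thesis
        by (rule that[of "{x}"]) (use x pos xh 1 goal_top in auto)
    next
      case 2
      show ?thesis
      proof (rule that[of "sphere 0 r"])
        show "connected (sphere 0 r :: 'a set)"
          by (rule connected_sphere) (rule dim)
        \<comment> \<open>Here \<open>x\<close> is the lowest point, so the whole sphere lies in the half-space.\<close>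
        show "\<forall>z\<in>sphere 0 r. norm z = r \<and> 0 < c \<bullet> z + b"
        proof
          fix z :: 'a
          assume z: "z \<in> sphere 0 r"
          then have "- (c \<bullet> z) \<le> norm c * r"
            using norm_cauchy_schwarz[of c "- z"] by simp
          moreover have "c \<bullet> x = - (norm c * r)"
            using 2 by (simp add: cz h_def)
          ultimately show "norm z = r \<and> 0 < c \<bullet> z + b"
            using pos z by simp
        qed
        show "x \<in> sphere 0 r" "(r / norm c) *\<^sub>R c \<in> sphere 0 r"
          using x c r0 by auto
      qed
    qed
  next
    case False
    then have vpos: "v \<bullet> v > 0"
      by simp
    have "h \<le> r"
    proof (rule power2_le_imp_le[OF _ r0])
      show "h\<^sup>2 \<le> r\<^sup>2"
        using vv vpos by linarith
    qed
    \<comment> \<open>Climb the meridian through \<open>x\<close>, parametrized by the height \<open>t\<close> over the equator.\<close>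
    define z where "z t = t *\<^sub>R e + sqrt ((r\<^sup>2 - t\<^sup>2) / (v \<bullet> v)) *\<^sub>R v" for t
    have ez: "e \<bullet> z t = t" for t
      by (simp add: z_def inner_add_right ev e)
    show ?thesis
    proof (rule that[of "z ` {h..r}"])
      show "connected (z ` {h..r})"
        unfolding z_def using vpos by (intro connected_continuous_image continuous_intros) auto
      have "z h = x"
        using vpos by (simp add: z_def vv[symmetric]) (simp add: v_def)
      then show "x \<in> z ` {h..r}"
        using \<open>h \<le> r\<close> by force
      have "z r = r *\<^sub>R e"
        by (simp add: z_def)
      then show "(r / norm c) *\<^sub>R c \<in> z ` {h..r}"
        unfolding goal_top using \<open>h \<le> r\<close> by force
      show "\<forall>y\<in>z ` {h..r}. norm y = r \<and> 0 < c \<bullet> y + b"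
      proof
        fix y
        assume "y \<in> z ` {h..r}"
        then obtain t where t: "h \<le> t" "t \<le> r" and y: "y = z t"
          by auto
        have "h\<^sup>2 < r\<^sup>2"
          using vv vpos by simp
        then have "\<bar>h\<bar> < r"
          by (intro power2_less_imp_less[OF _ r0]) simp
        then have "t\<^sup>2 \<le> r\<^sup>2"
          using t by (simp add: abs_le_square_iff[symmetric])
        then have nn: "0 \<le> (r\<^sup>2 - t\<^sup>2) / (v \<bullet> v)"
          using vpos by simp
        have "(t *\<^sub>R e + \<rho> *\<^sub>R v) \<bullet> (t *\<^sub>R e + \<rho> *\<^sub>R v) = t\<^sup>2 + \<rho>\<^sup>2 * (v \<bullet> v)" for \<rho>
          by (simp add: inner_add_left inner_add_right ev e power2_eq_square)
        then have "y \<bullet> y = t\<^sup>2 + (sqrt ((r\<^sup>2 - t\<^sup>2) / (v \<bullet> v)))\<^sup>2 * (v \<bullet> v)"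
          by (simp only: y z_def)
        also have "\<dots> = r\<^sup>2"
          using vpos nn by (simp only: real_sqrt_pow2) simp
        finally have "norm y = r"
          using r0 by (simp add: norm_eq_sqrt_inner)
        moreover have "c \<bullet> x \<le> c \<bullet> y"
          unfolding cz y ez h_def[symmetric] using t by (simp add: mult_left_mono)
        ultimately show "norm y = r \<and> 0 < c \<bullet> y + b"
          using pos by simp
      qed
    qed
  qed
qed

lemma config_space_iff:
  assumes "\<And>i. 0 \<le> s i"
  shows "q \<in> config_space s \<longleftrightarrow> (\<forall>i. q $ i \<bullet> q $ i = s i) \<and> oriented_volume q \<noteq> 0"
proof -
  have "norm (q $ i) = sqrt (s i) \<longleftrightarrow> q $ i \<bullet> q $ i = s i" for i
    by (simp add: norm_eq_sqrt_inner)
  then show ?thesis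
    by (simp add: config_space_def)
qed

lemma gram_matrix_kernel:
  "gram_matrix q *v w = 0" if "(\<Sum>i\<in>UNIV. w $ i *\<^sub>R q $ i) = 0"
proof -
  have "(gram_matrix q *v w) $ i = q $ i \<bullet> (\<Sum>j\<in>UNIV. w $ j *\<^sub>R q $ j)" for i
    by (simp add: matrix_vector_mult_def inner_sum_right mult.commute)
  then show ?thesis
    unfolding that by (simp add: vec_eq_iff)
qed

lemma det_eq_0_iff_kernel: "det A = 0 \<longleftrightarrow> (\<exists>x. x \<noteq> 0 \<and> A *v x = 0)" for A :: "real ^ 'n ^ 'n"
  by (metis invertible_det_nz invertible_left_inverse matrix_left_invertible_ker)

text \<open>A linear dependence among d + 1 vectors in dimension d is a kernel vector of their Gram
  matrix.\<close>

lemma det_gram_matrix: "det (gram_matrix q) = 0" for q :: "'n::finite config"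
proof -
  let ?f = "\<lambda>w :: real ^ 'n option. \<Sum>i\<in>UNIV. w $ i *\<^sub>R q $ i"
  have lin: "linear ?f"
    by (intro linearI) (simp_all add: scaleR_add_left sum.distrib scaleR_sum_right)
  have "\<not> inj ?f"
  proof
    assume "inj ?f"
    then have "dim (range ?f) = dim (UNIV :: (real ^ 'n option) set)"
      by (intro dim_image_eq[OF lin]) (auto intro: inj_on_subset)
    moreover have "dim (range ?f) \<le> CARD('n)"
      using dim_subset_UNIV[of "range ?f"] by simp
    ultimately show False
      by simp
  qed
  then obtain w where "w \<noteq> 0" "?f w = 0"
    using linear_injective_0[OF lin] by blast
  then show ?thesis
    using det_eq_0_iff_kernel gram_matrix_kernel by blast
qed

lemma replace_vertex_connected_component:
  assumes q: "q \<in> config_space s" and S: "connected S" "q $ i \<in> S" "x \<in> S"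
    and sub: "\<And>z. z \<in> S \<Longrightarrow> norm z = norm (q $ i) \<and> oriented_volume (replace_vertex q i z) \<noteq> 0"
  shows "connected_component (config_space s) q (replace_vertex q i x)"
proof (rule connected_componentI)
  have "continuous_on S (\<lambda>x. if j = i then x else q $ j)" for j
    by (cases "j = i") auto
  then show "connected (replace_vertex q i ` S)"
    unfolding replace_vertex_def
    by (intro connected_continuous_image S continuous_on_vec_lambda)
  show "replace_vertex q i ` S \<subseteq> config_space s"
    using q sub by (auto simp: config_space_def)
  show "q \<in> replace_vertex q i ` S"
    using S by (metis image_eqI replace_vertex_same)
qed (use S in auto)

text \<open>The top of the cap of vertex i lies in the component of q, so by maximality the vertex
  is already there: it is a positive multiple of the gradient c of the signed volume. Every other
  vertex satisfies \<open>c \<bullet> q $ j = - b\<close>, hence the equal scalar products. The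
  value b at the origin is smaller than the value at the vertex, which bounds the weight.\<close>

lemma maximal_volume_vertex:
  fixes q :: "'n::finite config"
  assumes dim: "2 \<le> CARD('n)" and q: "q \<in> config_space s"
    and max: "\<And>q'. connected_component (config_space s) q q' \<Longrightarrow>
        (oriented_volume q')\<^sup>2 \<le> (oriented_volume q)\<^sup>2"
    and nz: "q $ i \<noteq> 0"
    and w: "(\<Sum>i\<in>UNIV. w i) = 1" "(\<Sum>i\<in>UNIV. w i *\<^sub>R q $ i) = 0"
  shows "w i < 1" and "\<And>j k. j \<noteq> i \<Longrightarrow> k \<noteq> i \<Longrightarrow> q $ i \<bullet> q $ j = q $ i \<bullet> q $ k"
proof -
  let ?V = "oriented_volume q"
  have V: "?V \<noteq> 0"
    using q by (simp add: config_space_def)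
  obtain c' b' where cb': "\<And>x. oriented_volume (replace_vertex q i x) = c' \<bullet> x + b'"
    using oriented_volume_affine[of q i] by blast
  \<comment> \<open>The factor \<open>sgn ?V\<close> makes the affine function equal to
    \<open>\<bar>?V\<bar>\<close> at q, so that the cap of the right orientation is its positive
    part.\<close>
  define c where "c = sgn ?V *\<^sub>R c'"
  define b where "b = sgn ?V * b'"
  have cb: "c \<bullet> x + b = sgn ?V * oriented_volume (replace_vertex q i x)" for x
    by (simp add: c_def b_def cb' algebra_simps)
  have cq: "c \<bullet> q $ i + b = \<bar>?V\<bar>"
    by (simp add: cb abs_sgn mult.commute)
  have cj: "c \<bullet> q $ j + b = 0" if "j \<noteq> i" for j
    unfolding cb using oriented_volume_eq_vertices[of "replace_vertex q i (q $ j)" i j] that by simp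
  obtain j where j: "j \<noteq> i"
  proof (cases i)
    case None
    with that[of "Some undefined"] show ?thesis by simp
  next
    case (Some k)
    with that[of None] show ?thesis by simp
  qed
  have c0: "c \<noteq> 0"
    using cj[OF j] cq V by auto
  define y where "y = (norm (q $ i) / norm c) *\<^sub>R c"
  have pos: "0 < c \<bullet> q $ i + b"
    using V by (simp add: cq)
  have dim': "2 \<le> DIM(real ^ 'n)"
    using dim by simp
  obtain S where S: "connected S" "q $ i \<in> S" "y \<in> S"
    and Sz: "\<forall>z\<in>S. norm z = norm (q $ i) \<and> 0 < c \<bullet> z + b"
    using connected_in_sphere_cap[OF dim' refl pos c0, folded y_def] by blast
  have "connected_component (config_space s) q (replace_vertex q i y)"
    by (rule replace_vertex_connected_component[OF q S]) (use Sz cb in force)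
  from max[OF this] have "(c \<bullet> y + b)\<^sup>2 \<le> (c \<bullet> q $ i + b)\<^sup>2"
    using V by (simp add: cb power_mult_distrib sgn_if)
  then have "c \<bullet> y + b \<le> c \<bullet> q $ i + b"
    using pos power2_le_imp_le by fastforce
  moreover have "c \<bullet> y = norm c * norm (q $ i)"
    using c0 by (simp add: y_def dot_square_norm power2_eq_square)
  \<comment> \<open>Equality in Cauchy-Schwarz: no point of the sphere exceeds the top, and the top
    does not exceed the vertex.\<close>
  ultimately have "c \<bullet> q $ i = norm c * norm (q $ i)"
    using norm_cauchy_schwarz[of c "q $ i"] by simp
  then have par: "norm c *\<^sub>R q $ i = norm (q $ i) *\<^sub>R c" and cqpos: "0 < c \<bullet> q $ i"
    using nz c0 by (simp add: norm_cauchy_schwarz_eq, simp)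
  have "norm c * (q $ i \<bullet> q $ j) = - (norm (q $ i) * b)" if "j \<noteq> i" for j
    using cj[OF that] arg_cong[OF par, of "\<lambda>z. z \<bullet> q $ j"] by (simp add: add_eq_0_iff)
  then show "q $ i \<bullet> q $ j = q $ i \<bullet> q $ k" if "j \<noteq> i" "k \<noteq> i" for j k
    using that c0 by (metis mult_cancel_left norm_eq_zero)
  have "b = w i * \<bar>?V\<bar>"
    using cb[of 0] oriented_volume_barycentric[OF w, of i] by (simp add: abs_sgn mult_ac)
  then have "w i * \<bar>?V\<bar> < 1 * \<bar>?V\<bar>"
    using cqpos cq by simp
  then show "w i < 1"
    using V by simp
qed

lemma equi_gram_gram_matrix:
  assumes "\<And>i. q $ i \<bullet> q $ i = s i" "\<And>i j. i \<noteq> j \<Longrightarrow> q $ i \<bullet> q $ j = \<beta>"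
  shows "gram_matrix q = equi_gram_matrix s \<beta>"
  using assms by (simp add: vec_eq_iff equi_gram_matrix_def)

text \<open>Pairing the barycentric relation of the origin with \<open>q $ i\<close> gives
  \<open>w i * s i = - (\<beta> * (1 - w i))\<close>. Since \<open>w i < 1\<close>, a nonnegative
  \<beta> would make all weights nonpositive, although they sum to 1.\<close>

lemma maximal_volume_equiangular:
  fixes q :: "'n::finite config"
  assumes dim: "2 \<le> CARD('n)" and s: "\<And>i. 0 < s i" and q: "q \<in> config_space s"
    and max: "\<And>q'. connected_component (config_space s) q q' \<Longrightarrow>
        (oriented_volume q')\<^sup>2 \<le> (oriented_volume q)\<^sup>2"
  obtains \<beta> where "\<beta> < 0" "gram_matrix q = equi_gram_matrix s \<beta>"
proof -
  have qs: "\<And>i. q $ i \<bullet> q $ i = s i" and V: "oriented_volume q \<noteq> 0"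
    using q s by (simp_all add: config_space_iff less_imp_le)
  have nz: "q $ i \<noteq> 0" for i
    using qs[of i] s[of i] by auto
  obtain w where w: "(\<Sum>i\<in>UNIV. w i) = 1" "(\<Sum>i\<in>UNIV. w i *\<^sub>R q $ i) = 0"
    using barycentric_origin[OF V] by blast
  note w1 = maximal_volume_vertex(1)[OF dim q max nz w]
  note opp = maximal_volume_vertex(2)[OF dim q max nz w]
  define \<beta> where "\<beta> = q $ None \<bullet> q $ Some undefined"
  have off: "q $ i \<bullet> q $ j = \<beta>" if "i \<noteq> j" for i j
  proof -
    \<comment> \<open>Equality is known only for two pairs with a common index. The pairs {i, j} and
      {k, l} are linked through {i, k}, which is no pair when \<open>i = k\<close>; then they share
      an index already.\<close>
    have "q $ i \<bullet> q $ j = q $ k \<bullet> q $ l" if "i \<noteq> j" "k \<noteq> l" for i j k l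
      using opp[of j i k] opp[of i k l] opp[of j i l] that
      by (cases "i = k") (simp_all add: inner_commute)
    from this[OF that, of None "Some undefined"] show ?thesis
      by (simp add: \<beta>_def)
  qed
  have rel: "w i * s i = - (\<beta> * (1 - w i))" for i
  proof -
    have "0 = q $ i \<bullet> (\<Sum>j\<in>UNIV. w j *\<^sub>R q $ j)"
      by (simp add: w)
    also have "\<dots> = (\<Sum>j\<in>UNIV. w j * \<beta> + (if j = i then w i * (s i - \<beta>) else 0))"
      unfolding inner_sum_right by (rule sum.cong) (auto simp: off qs algebra_simps)
    also have "\<dots> = \<beta> + w i * (s i - \<beta>)"
      by (simp add: sum.distrib sum_distrib_right[symmetric] w)
    finally show ?thesis
      by (simp add: algebra_simps)
  qed
  have "\<beta> < 0"
  proof (rule ccontr)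
    assume "\<not> \<beta> < 0"
    then have "w i * s i \<le> 0" for i
      using w1[of i] by (simp add: rel)
    then have "w i \<le> 0" for i
      using s[of i] by (meson mult_pos_pos not_le)
    then have "(\<Sum>i\<in>UNIV. w i) \<le> 0"
      by (simp add: sum_nonpos)
    with w show False
      by simp
  qed
  with that equi_gram_gram_matrix[OF qs off] show ?thesis
    by blast
qed

text \<open>A kernel vector w with coordinate sum \<sigma> satisfies
  \<open>(s i - \<gamma>) * w $ i = - \<gamma> * \<sigma>\<close>. If \<sigma> were 0, w would
  vanish; dividing by \<sigma> and summing over i gives the equation \<open>root\<close>, whose left
  side is strictly decreasing for negative \<gamma>.\<close>

lemma negative_root_unique:
  fixes s :: "'i::finite \<Rightarrow> real"
  assumes s: "\<And>i. 0 < s i"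
    and "\<alpha> < 0" "det (equi_gram_matrix s \<alpha>) = 0" "\<beta> < 0" "det (equi_gram_matrix s \<beta>) = 0"
  shows "\<alpha> = \<beta>"
proof -
  have root: "(\<Sum>i\<in>UNIV. - \<gamma> / (s i - \<gamma>)) = 1" if \<gamma>: "\<gamma> < 0" "det (equi_gram_matrix s \<gamma>) = 0" for \<gamma>
  proof -
    have pos: "0 < s i - \<gamma>" for i
      using s[of i] \<gamma> by simp
    obtain w where w: "w \<noteq> 0" "equi_gram_matrix s \<gamma> *v w = 0"
      using \<gamma> det_eq_0_iff_kernel by blast
    define \<sigma> where "\<sigma> = (\<Sum>j\<in>UNIV. w $ j)"
    have wi: "w $ i = (- \<gamma> / (s i - \<gamma>)) * \<sigma>" for i
    proof -
      have "0 = (equi_gram_matrix s \<gamma> *v w) $ i"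
        by (simp add: w)
      also have "\<dots> = (\<Sum>j\<in>UNIV. \<gamma> * w $ j + (if j = i then (s i - \<gamma>) * w $ i else 0))"
        by (auto simp: matrix_vector_mult_def equi_gram_matrix_def algebra_simps intro!: sum.cong)
      also have "\<dots> = \<gamma> * \<sigma> + (s i - \<gamma>) * w $ i"
        by (simp add: sum.distrib sum_distrib_left[symmetric] \<sigma>_def)
      finally show ?thesis
        using pos[of i] by (simp add: field_simps)
    qed
    have "\<sigma> \<noteq> 0"
      using wi w(1) by (auto simp: vec_eq_iff)
    moreover have "\<sigma> = (\<Sum>i\<in>UNIV. - \<gamma> / (s i - \<gamma>)) * \<sigma>"
      unfolding sum_distrib_right wi[symmetric] by (rule \<sigma>_def)
    ultimately show ?thesis
      by simp
  qed
  have less: "(\<Sum>i\<in>UNIV. - \<delta> / (s i - \<delta>)) < (\<Sum>i\<in>UNIV. - \<gamma> / (s i - \<gamma>))"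
    if "\<gamma> < \<delta>" "\<delta> < 0" for \<gamma> \<delta>
  proof (rule sum_strict_mono)
    show "- \<delta> / (s i - \<delta>) < - \<gamma> / (s i - \<gamma>)" for i
    proof -
      have "0 < s i - \<delta>" "0 < s i - \<gamma>" "s i * \<gamma> < s i * \<delta>"
        using s[of i] that by auto
      then show ?thesis
        by (simp add: divide_simps) (simp add: algebra_simps)
    qed
  qed auto
  from root[OF assms(2,3)] root[OF assms(4,5)] less[of \<alpha> \<beta>] less[of \<beta> \<alpha>] show ?thesis
    using assms by linarith
qed

section \<open>Connected components of the configuration space\<close>

text \<open>This is the reflection in the hyperplane orthogonal to a only when a is a unit vector.
  Without normalization the entries are polynomials in a, so continuity in a is immediate.\<close>

definition householder :: "real ^ 'n \<Rightarrow> real ^ 'n ^ 'n::finite" where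
  "householder a = (\<chi> i j. (if i = j then 1 else 0) - 2 * a $ i * a $ j)"

lemma householder_mult: "householder a *v x = x - (2 * (a \<bullet> x)) *\<^sub>R a"
proof -
  have "(\<Sum>j\<in>UNIV. (if i = j then x $ j else 0) - 2 * a $ i * a $ j * x $ j)
      = x $ i - 2 * a $ i * (\<Sum>j\<in>UNIV. a $ j * x $ j)" for i
    by (simp add: sum_subtractf sum_distrib_left mult.assoc)
  moreover have "((if i = j then 1 else 0) - 2 * a $ i * a $ j) * x $ j
      = (if i = j then x $ j else 0) - 2 * a $ i * a $ j * x $ j" for i j
    by (simp add: left_diff_distrib)
  ultimately show ?thesis
    by (simp add: vec_eq_iff householder_def matrix_vector_mult_def inner_vec_def mult_ac)
qed

lemma householder_involution: "norm a = 1 \<Longrightarrow> householder a ** householder a = mat 1"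
  by (simp add: matrix_eq matrix_vector_mul_assoc[symmetric] householder_mult inner_diff_right
      dot_square_norm)

lemma transpose_householder [simp]: "transpose (householder a) = householder a"
  by (simp add: transpose_def householder_def vec_eq_iff mult_ac)

lemma orthogonal_householder: "norm a = 1 \<Longrightarrow> orthogonal_matrix (householder a)"
  by (simp add: orthogonal_matrix householder_involution)

text \<open>The mirror is the perpendicular bisector of x and y, which passes through the origin
  because the norms agree.\<close>

lemma householder_swap:
  assumes "norm x = norm y" "x \<noteq> y"
  shows "householder ((x - y) /\<^sub>R norm (x - y)) *v x = y"
proof -
  have "2 * ((x - y) \<bullet> x) = (norm (x - y))\<^sup>2"
    using assms(1) by (simp add: power2_norm_eq_inner inner_diff inner_commute norm_eq)
  then have "2 * ((x - y) \<bullet> x) / (norm (x - y))\<^sup>2 = 1"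
    using assms(2) by (simp only:) simp
  moreover have "householder ((x - y) /\<^sub>R norm (x - y)) *v x
      = x - (2 * ((x - y) \<bullet> x) / (norm (x - y))\<^sup>2) *\<^sub>R (x - y)"
    by (simp add: householder_mult power2_eq_square divide_inverse mult_ac)
  ultimately show ?thesis
    by (simp only: scaleR_one) simp
qed

lemma orthogonal_matrix_inner:
  fixes A :: "real ^ 'n ^ 'n"
  assumes "orthogonal_matrix A"
  shows "(A *v x) \<bullet> (A *v y) = x \<bullet> y"
proof -
  have "(A *v x) \<bullet> (A *v y) = (transpose A *v (A *v x)) \<bullet> y"
    by (simp add: dot_lmul_matrix)
  also have "transpose A *v (A *v x) = x"
    using assms by (simp only: matrix_vector_mul_assoc orthogonal_matrix matrix_vector_mul_lid)
  finally show ?thesis .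
qed

text \<open>A rotation carrying a basis vector to a conjugates the reflection to a diagonal matrix
  with a single entry -1.\<close>

lemma det_householder:
  fixes a :: "real ^ 'n::finite"
  assumes "2 \<le> CARD('n)" "norm a = 1"
  shows "det (householder a) = - 1"
proof -
  fix k :: 'n
  obtain A where A: "rotation_matrix A" "A *v axis k 1 = a"
    using rotation_matrix_exists_basis[OF assms] by blast
  then have detA: "det A = 1"
    by (simp add: rotation_matrix_def)
  note inner = orthogonal_matrix_inner[OF A(1)[unfolded rotation_matrix_def, THEN conjunct1]]
  have "householder a ** A = A ** householder (axis k 1)"
    by (simp add: matrix_eq matrix_vector_mul_assoc[symmetric] householder_mult A(2)[symmetric] inner
        matrix_vector_mult_diff_distrib matrix_vector_mult_scaleR)
  then have "det (householder a) = det (householder (axis k 1 :: real^'n))"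
    using detA by (metis det_mul mult.right_neutral mult.left_neutral)
  also have "\<dots> = (\<Prod>i\<in>UNIV. householder (axis k 1 :: real^'n) $ i $ i)"
    by (rule det_diagonal) (auto simp: householder_def axis_def)
  also have "(\<lambda>i. householder (axis k 1 :: real^'n) $ i $ i) = (\<lambda>i. if i = k then - 1 else 1)"
    by (simp add: householder_def axis_def fun_eq_iff)
  finally show ?thesis
    by simp
qed

definition householder_product :: "(real ^ 'n) list \<Rightarrow> real ^ 'n ^ 'n::finite" where
  "householder_product as = foldr (\<lambda>a M. householder a ** M) as (mat 1)"

lemma householder_product_simps [simp]:
  "householder_product [] = mat 1"
  "householder_product (a # as) = householder a ** householder_product as"
  by (simp_all add: householder_product_def)

lemma orthogonal_householder_product:
  "\<forall>a\<in>set as. norm a = 1 \<Longrightarrow> orthogonal_matrix (householder_product as)"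
  by (induction as) (simp_all add: orthogonal_matrix_id orthogonal_matrix_mul orthogonal_householder)

lemma det_householder_product:
  fixes as :: "(real ^ 'n::finite) list"
  assumes "2 \<le> CARD('n)"
  shows "\<forall>a\<in>set as. norm a = 1 \<Longrightarrow> det (householder_product as) = (- 1) ^ length as"
  using assms by (induction as) (simp_all add: det_mul det_householder)

text \<open>The Cartan-Dieudonne argument, by induction on a set J of basis vectors that R may move.
  One reflection takes \<open>R *v axis k 1\<close> back to \<open>axis k 1\<close>; its normal is
  orthogonal to the basis vectors fixed by R, so these stay fixed.\<close>

lemma orthogonal_matrix_eq_householder_product:
  fixes R :: "real ^ 'n::finite ^ 'n"
  assumes "orthogonal_matrix R"
  obtains as where "\<forall>a\<in>set as. norm a = 1" "R = householder_product as"
proof -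
  have "\<exists>as. (\<forall>a\<in>set as. norm a = 1) \<and> R = householder_product as"
    if "finite J" "orthogonal_matrix R" "\<And>i. i \<notin> J \<Longrightarrow> R *v axis i 1 = axis i 1"
    for J and R :: "real ^ 'n ^ 'n"
    using that
  proof (induction J arbitrary: R rule: finite_induct)
    case empty
    then have "column i R = axis i 1" for i
      by (simp add: matrix_vector_mult_basis)
    then have "R = mat 1"
      by (simp add: vec_eq_iff column_def mat_def axis_def)
    then show ?case
      by (intro exI[of _ "[]"]) simp
  next
    case (insert k J)
    show ?case
    proof (cases "R *v axis k 1 = axis k 1")
      case True
      with insert.prems show ?thesis
        by (intro insert.IH) (metis insert_iff)+
    next
      case False
      define a where "a = (R *v axis k 1 - axis k 1) /\<^sub>R norm (R *v axis k 1 - axis k 1)"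
      have a: "norm a = 1"
        using False by (simp add: a_def)
      note inner = orthogonal_matrix_inner[OF insert.prems(1)]
      have "norm (R *v axis k 1) = norm (axis k 1 :: real^'n)"
        by (simp add: norm_eq_sqrt_inner inner)
      then have k: "householder a *v (R *v axis k 1) = axis k 1"
        unfolding a_def using False by (rule householder_swap)
      have "\<exists>as. (\<forall>a\<in>set as. norm a = 1) \<and> householder a ** R = householder_product as"
      proof (rule insert.IH)
        show "orthogonal_matrix (householder a ** R)"
          by (intro orthogonal_matrix_mul orthogonal_householder a insert.prems)
        show "(householder a ** R) *v axis i 1 = axis i 1" if "i \<notin> J" for i
        proof (cases "i = k")
          case True
          then show ?thesis
            using k by (simp add: matrix_vector_mul_assoc)
        next
          case False
          with that insert.prems have i: "R *v axis i 1 = axis i 1"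
            by simp
          have "(R *v axis k 1) \<bullet> axis i 1 = axis k (1::real) \<bullet> axis i 1"
            by (metis i inner)
          then have "a \<bullet> axis i 1 = 0"
            by (simp add: a_def inner_diff_left)
          then show ?thesis
            by (simp add: matrix_vector_mul_assoc[symmetric] i householder_mult)
        qed
      qed
      then obtain as where as: "\<forall>a\<in>set as. norm a = 1" "householder a ** R = householder_product as"
        by blast
      have "R = householder_product (a # as)"
        by (simp flip: as(2)) (simp add: matrix_mul_assoc householder_involution[OF a])
      with as(1) a show ?thesis
        by (intro exI[of _ "a # as"]) simp
    qed
  qed
  from this[of UNIV R] assms that show ?thesis
    by auto
qed

lemma continuous_on_matrix_mult [continuous_intros]:
  fixes f g :: "'a::topological_space \<Rightarrow> real ^ 'n::finite ^ 'n"
  assumes "continuous_on S f" "continuous_on S g"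
  shows "continuous_on S (\<lambda>x. f x ** g x)"
  unfolding matrix_matrix_mult_def using assms by (intro continuous_intros)

text \<open>A rotation is a product of an even number of reflections. Two adjacent ones are deformed
  away by moving one normal over the unit sphere, which is connected in dimension at least 2, until
  it meets the other.\<close>

lemma connected_special_orthogonal_group:
  assumes dim: "2 \<le> CARD('n::finite)"
  shows "connected (special_orthogonal_group :: (real ^ 'n ^ 'n) set)"
proof -
  let ?SO = "special_orthogonal_group :: (real ^ 'n ^ 'n) set"
  have rot: "householder_product as \<in> ?SO" if "\<forall>a\<in>set as. norm a = 1" "even (length as)" for as
    using that dim
    by (simp add: special_orthogonal_group_def rotation_matrix_def orthogonal_householder_product
        det_householder_product)
  have product: "connected_component ?SO (mat 1) (householder_product as)"
    if "\<forall>a\<in>set as. norm a = 1" "even (length as)" for as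
    using that
  proof (induction as rule: induct_list012)
    case 1
    then show ?case
      using rot[of "[]"] by simp
  next
    case (3 b a as)
    then have a: "norm a = 1" and b: "norm b = 1" and as: "\<forall>a\<in>set as. norm a = 1" "even (length as)"
      by auto
    \<comment> \<open>At \<open>z = b\<close> this is the given product; at \<open>z = a\<close> its
      first two reflections cancel.\<close>
    let ?f = "\<lambda>z. householder z ** (householder a ** householder_product as)"
    have "connected_component ?SO (?f a) (?f b)"
    proof (rule connected_componentI)
      have "connected (sphere 0 1 :: (real ^ 'n) set)"
        by (rule connected_sphere) (use dim in simp)
      then show "connected (?f ` sphere 0 1)"
        by (rule connected_continuous_image[rotated])
          (auto simp: householder_def intro!: continuous_intros)
      show "?f ` sphere 0 1 \<subseteq> ?SO"
        using rot[of "_ # a # as"] a as by auto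
    qed (use a b in auto)
    moreover have "?f a = householder_product as"
      by (simp add: matrix_mul_assoc householder_involution[OF a])
    ultimately show ?case
      using 3(1)[OF as] by (auto intro: connected_component_trans)
  qed simp
  have "connected_component ?SO (mat 1) A" if A: "A \<in> ?SO" for A
  proof -
    obtain as where as: "\<forall>a\<in>set as. norm a = 1" "A = householder_product as"
      using A orthogonal_matrix_eq_householder_product[of A]
      by (auto simp: special_orthogonal_group_def rotation_matrix_def)
    moreover have "(- 1 :: real) ^ length as = 1"
      using A det_householder_product[OF dim as(1)]
      by (simp add: special_orthogonal_group_def rotation_matrix_def as)
    then have "even (length as)"
      by (metis neg_one_odd_power one_neq_neg_one)
    ultimately show ?thesis
      using product by blast
  qed
  then show ?thesis
    unfolding connected_iff_connected_component
    by (blast intro: connected_component_sym connected_component_trans)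
qed

section \<open>Configurations up to isometry, and volume maxima in components\<close>

text \<open>The edge vectors of q form a basis, so A is forced to be \<open>M q' ** N\<close>, and
  it is orthogonal because the edge Gram matrices agree. That A also carries vertex
  \<open>None\<close> correctly is tested against the edges of q', which form a basis as
  well.\<close>

lemma gram_matrix_eq_imp_orthogonal:
  fixes q q' :: "'n::finite config"
  assumes V: "oriented_volume q \<noteq> 0" and G: "gram_matrix q = gram_matrix q'"
  obtains A where "orthogonal_matrix A" "q' = (\<chi> i. A *v q $ i)"
proof -
  define M where "M q = (\<chi> i j. (q $ Some j - q $ None) $ i)" for q :: "'n config"
  have colM: "M q *v axis j 1 = q $ Some j - q $ None" for q :: "'n config" and j
    by (simp add: matrix_vector_mult_basis column_def M_def vec_eq_iff)
  have detM: "det (M q) = oriented_volume q" for q :: "'n config"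
    by (simp add: M_def oriented_volume_def)
  have MM: "transpose (M q) ** M q = edge_gram (gram_matrix q)" for q :: "'n config"
    by (simp add: vec_eq_iff edge_gram_gram_matrix matrix_matrix_mult_def transpose_def inner_vec_def M_def)
  have Gij: "q $ i \<bullet> q $ j = q' $ i \<bullet> q' $ j" for i j
    using arg_cong[OF G, of "\<lambda>G. G $ i $ j"] by simp
  have Mq0: "transpose (M q) *v q $ None = transpose (M q') *v q' $ None"
  proof -
    have "(transpose (M q) *v x) $ j = (q $ Some j - q $ None) \<bullet> x" for q :: "'n config" and x j
      by (simp add: matrix_vector_mult_def transpose_def M_def inner_vec_def)
    then show ?thesis
      by (simp add: vec_eq_iff inner_diff_left Gij)
  qed
  obtain N where N: "M q ** N = mat 1" "N ** M q = mat 1"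
    using V by (metis detM invertible_det_nz invertible_def)
  have "oriented_volume q' \<noteq> 0"
    using V G by (metis det_edge_gram power2_eq_iff zero_power2 power_eq_0_iff)
  then have "invertible (transpose (M q'))"
    by (simp add: invertible_det_nz detM)
  then have inj: "x = y" if "transpose (M q') *v x = transpose (M q') *v y" for x y
    using that by (metis invertible_def matrix_vector_mul_assoc matrix_vector_mul_lid)
  define A where "A = M q' ** N"
  have "transpose A ** A = transpose N ** (transpose (M q') ** M q') ** N"
    by (simp add: A_def matrix_transpose_mul matrix_mul_assoc)
  also have "transpose (M q') ** M q' = transpose (M q) ** M q"
    by (simp add: MM G)
  also have "transpose N ** (transpose (M q) ** M q) ** N = transpose (M q ** N) ** (M q ** N)"
    by (simp only: matrix_transpose_mul matrix_mul_assoc)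
  finally have "orthogonal_matrix A"
    by (simp add: orthogonal_matrix N transpose_mat)
  moreover have A0: "A *v q $ None = q' $ None"
  proof (rule inj)
    have "transpose (M q') *v (A *v q $ None) = (transpose (M q') ** M q') *v (N *v q $ None)"
      by (simp add: A_def matrix_vector_mul_assoc matrix_mul_assoc)
    also have "\<dots> = transpose (M q) *v ((M q ** N) *v q $ None)"
      by (simp only: MM G[symmetric]) (simp only: MM[symmetric] matrix_vector_mul_assoc matrix_mul_assoc)
    finally show "transpose (M q') *v (A *v q $ None) = transpose (M q') *v q' $ None"
      using Mq0 by (simp add: N)
  qed
  moreover have "A *v q $ Some j = q' $ Some j" for j
  proof -
    have "A *v (q $ Some j - q $ None) = (A ** M q) *v axis j 1"
      by (simp add: colM[symmetric] matrix_vector_mul_assoc)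
    also have "A ** M q = M q'"
      by (simp add: A_def matrix_mul_assoc[symmetric] N)
    finally show ?thesis
      by (simp add: colM matrix_vector_mult_diff_distrib A0)
  qed
  ultimately show ?thesis
    by (intro that[of A]) (auto simp: vec_eq_iff[of q'] split_option_all)
qed

lemma gram_matrix_orthogonal:
  "orthogonal_matrix A \<Longrightarrow> gram_matrix (\<chi> i. A *v q $ i) = gram_matrix q"
  by (simp add: vec_eq_iff orthogonal_matrix_inner)

lemma orthogonal_config_space:
  assumes "orthogonal_matrix A" "q \<in> config_space s"
  shows "(\<chi> i. A *v q $ i) \<in> config_space s"
  using assms det_orthogonal_matrix[of A]
  by (auto simp: config_space_def oriented_volume_matrix_mult norm_eq_sqrt_inner orthogonal_matrix_inner)

lemma connected_component_rotation:
  fixes q :: "'n::finite config"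
  assumes "2 \<le> CARD('n)" "q \<in> config_space s" "rotation_matrix A"
  shows "connected_component (config_space s) q (\<chi> i. A *v q $ i)"
proof (rule connected_componentI)
  let ?f = "\<lambda>A. \<chi> i. A *v q $ i"
  show "connected (?f ` special_orthogonal_group)"
    by (rule connected_continuous_image[OF _ connected_special_orthogonal_group[OF assms(1)]])
      (auto simp: matrix_vector_mult_def intro!: continuous_intros)
  show "?f ` special_orthogonal_group \<subseteq> config_space s"
    using assms by (auto simp: special_orthogonal_group_def rotation_matrix_def intro: orthogonal_config_space)
  have "q = ?f (mat 1)"
    by (simp add: vec_eq_iff)
  then show "q \<in> ?f ` special_orthogonal_group"
    by (rule image_eqI) (simp add: special_orthogonal_group_def rotation_matrix_def orthogonal_matrix_id)
  show "?f A \<in> ?f ` special_orthogonal_group"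
    using assms by (auto simp: special_orthogonal_group_def)
qed

text \<open>The compact space obtained by dropping the volume condition; limits of configurations
  are taken here.\<close>

definition sphere_product :: "('n::finite option \<Rightarrow> real) \<Rightarrow> 'n config set" where
  "sphere_product s = {q. \<forall>i. norm (q $ i) = sqrt (s i)}"

lemma compact_sphere_product: "compact (sphere_product s)"
proof -
  have "norm q \<le> (\<Sum>i\<in>UNIV. sqrt (s i))" if "q \<in> sphere_product s" for q
  proof -
    have "norm q \<le> (\<Sum>i\<in>UNIV. norm (q $ i))"
      unfolding norm_vec_def[of q] by (rule L2_set_le_sum) simp
    with that show ?thesis
      by (simp add: sphere_product_def)
  qed
  moreover have "closed (sphere_product s)"
    unfolding sphere_product_def by (intro closed_Collect_all closed_Collect_eq continuous_intros)
  ultimately show ?thesis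
    by (auto simp: compact_eq_bounded_closed bounded_iff)
qed

lemma config_space_eq: "config_space s = {q \<in> sphere_product s. oriented_volume q \<noteq> 0}"
  by (auto simp: config_space_def sphere_product_def)

text \<open>A maximizer over the compact closure has positive squared volume, as q has, so it lies
  in the configuration space; adjoining a limit point to the component keeps it connected.\<close>

lemma maximal_volume_in_component:
  assumes q: "q \<in> config_space s"
  obtains e where "connected_component (config_space s) q e"
    "\<And>q'. connected_component (config_space s) q q' \<Longrightarrow> (oriented_volume q')\<^sup>2 \<le> (oriented_volume e)\<^sup>2"
proof -
  let ?C = "connected_component_set (config_space s) q"
  have qC: "q \<in> ?C"
    using q by simp
  have "?C \<subseteq> sphere_product s"
    using connected_component_subset[of "config_space s" q] by (auto simp: config_space_eq)
  then have sub: "closure ?C \<subseteq> sphere_product s"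
    by (intro closure_minimal compact_imp_closed compact_sphere_product)
  then have compact: "compact (closure ?C)"
    by (metis closed_closure compact_Int_closed compact_sphere_product inf.absorb_iff2)
  have nonempty: "closure ?C \<noteq> {}"
    using qC closure_subset by blast
  have "continuous_on (closure ?C) (\<lambda>q. (oriented_volume q)\<^sup>2)"
    by (intro continuous_intros)
  note sup = continuous_attains_sup[OF compact nonempty this]
  then obtain e where e: "e \<in> closure ?C"
    and max: "\<And>q'. q' \<in> closure ?C \<Longrightarrow> (oriented_volume q')\<^sup>2 \<le> (oriented_volume e)\<^sup>2"
    by blast
  have "(oriented_volume q)\<^sup>2 \<le> (oriented_volume e)\<^sup>2"
    by (rule max) (rule subsetD[OF closure_subset qC])
  moreover have "0 < (oriented_volume q)\<^sup>2"
    using q by (simp add: config_space_eq)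
  ultimately have "oriented_volume e \<noteq> 0"
    by auto
  then have eX: "e \<in> config_space s"
    using e sub by (auto simp: config_space_eq)
  have "connected_component (config_space s) q e"
  proof (rule connected_componentI)
    show "connected (insert e ?C)"
      by (rule connected_intermediate_closure[of ?C]) (use e closure_subset[of ?C] in blast)+
    show "insert e ?C \<subseteq> config_space s"
      using eX connected_component_subset by blast
  qed (use q in auto)
  then show ?thesis
    using that max closure_subset by blast
qed

lemma connected_component_volume_sign:
  assumes "connected_component (config_space s) q q'"
  shows "0 < oriented_volume q * oriented_volume q'"
proof -
  obtain T where T: "connected T" "T \<subseteq> config_space s" "q \<in> T" "q' \<in> T"
    using assms by (auto simp: connected_component_def)
  have con: "connected (oriented_volume ` T)"
    by (intro connected_continuous_image T continuous_intros)
  have "0 \<notin> oriented_volume ` T"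
    using T by (auto simp: config_space_def)
  then show ?thesis
    using connectedD_interval[OF con, of "oriented_volume q" "oriented_volume q'" 0]
      connectedD_interval[OF con, of "oriented_volume q'" "oriented_volume q" 0] T
    by (force simp: zero_less_mult_iff not_le)
qed

lemma equiangular_in_component:
  fixes q :: "'n::finite config"
  assumes dim: "2 \<le> CARD('n)" and s: "\<And>i. 0 < s i" and q: "q \<in> config_space s"
  obtains e \<beta> where "connected_component (config_space s) q e"
    "\<beta> < 0" "gram_matrix e = equi_gram_matrix s \<beta>"
    "\<And>q'. connected_component (config_space s) q q' \<Longrightarrow> (oriented_volume q')\<^sup>2 \<le> (oriented_volume e)\<^sup>2"
proof -
  obtain e where e: "connected_component (config_space s) q e"
    and max: "\<And>q'. connected_component (config_space s) q q' \<Longrightarrow> (oriented_volume q')\<^sup>2 \<le> (oriented_volume e)\<^sup>2"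
    using maximal_volume_in_component[OF q] by blast
  have "e \<in> config_space s"
    using e connected_component_in by blast
  moreover have "(oriented_volume q')\<^sup>2 \<le> (oriented_volume e)\<^sup>2"
    if "connected_component (config_space s) e q'" for q'
    by (rule max) (rule connected_component_trans[OF e that])
  ultimately obtain \<beta> where "\<beta> < 0" "gram_matrix e = equi_gram_matrix s \<beta>"
    using maximal_volume_equiangular[where s = s and q = e, OF dim s] by blast
  with that e max show ?thesis
    by blast
qed

lemma rotation_of_gram_matrix_eq:
  assumes G: "gram_matrix q = gram_matrix q'" and pos: "0 < oriented_volume q * oriented_volume q'"
  obtains A where "rotation_matrix A" "q' = (\<chi> i. A *v q $ i)"
proof -
  have "oriented_volume q \<noteq> 0"
    using pos by auto
  then obtain A where A: "orthogonal_matrix A" "q' = (\<chi> i. A *v q $ i)"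
    using gram_matrix_eq_imp_orthogonal G by blast
  then have "0 < det A * (oriented_volume q)\<^sup>2"
    using pos by (simp add: oriented_volume_matrix_mult power2_eq_square mult_ac)
  then have "det A = 1"
    using det_orthogonal_matrix[OF A(1)] by (auto simp: zero_less_mult_iff)
  with A that show ?thesis
    by (auto simp: rotation_matrix_def)
qed

lemma det_gram_equi_root:
  assumes "gram_matrix e = equi_gram_matrix s \<beta>"
  shows "det (equi_gram_matrix s \<beta>) = 0"
  using assms det_gram_matrix by metis

text \<open>For the converse of the sign condition, q and q' are joined through the equiangular
  maximizers of their components: these share the one negative root, so with volumes of equal sign
  they differ by a rotation.\<close>

lemma connected_component_config_space:
  fixes q q' :: "'n::finite config"
  assumes dim: "2 \<le> CARD('n)" and s: "\<And>i. 0 < s i"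
    and q: "q \<in> config_space s" "q' \<in> config_space s"
  shows "connected_component (config_space s) q q' \<longleftrightarrow> 0 < oriented_volume q * oriented_volume q'"
proof
  assume pos: "0 < oriented_volume q * oriented_volume q'"
  obtain e \<beta> where e: "connected_component (config_space s) q e"
    "\<beta> < 0" "gram_matrix e = equi_gram_matrix s \<beta>"
    using equiangular_in_component[OF dim s q(1)] by blast
  obtain e' \<beta>' where e': "connected_component (config_space s) q' e'"
    "\<beta>' < 0" "gram_matrix e' = equi_gram_matrix s \<beta>'"
    using equiangular_in_component[OF dim s q(2)] by blast
  have "\<beta> = \<beta>'"
    by (rule negative_root_unique[OF s e(2) det_gram_equi_root[OF e(3)] e'(2) det_gram_equi_root[OF e'(3)]])
  then have "gram_matrix e = gram_matrix e'"
    using e e' by simp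
  moreover have "0 < oriented_volume e * oriented_volume e'"
    using connected_component_volume_sign[OF e(1)] connected_component_volume_sign[OF e'(1)] pos
    by (auto simp: zero_less_mult_iff)
  ultimately obtain A where A: "rotation_matrix A" "e' = (\<chi> i. A *v e $ i)"
    using rotation_of_gram_matrix_eq by blast
  have "connected_component (config_space s) e e'"
    unfolding A(2) using connected_component_rotation[OF dim _ A(1)] e(1) connected_component_in by blast
  then show "connected_component (config_space s) q q'"
    using e(1) e'(1) by (meson connected_component_sym connected_component_trans)
qed (rule connected_component_volume_sign)

section \<open>The convex body of Gram matrices\<close>

text \<open>At a zero of the form, moving in direction y = G x changes the value by
  \<open>2 * t * (y \<bullet> y)\<close> to first order. Unless y = 0, a small negative step would
  make the form negative.\<close>

lemma semidefinite_kernel: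
  fixes G :: "real ^ 'i ^ 'i::finite"
  assumes sym: "transpose G = G" and psd: "\<And>x. 0 \<le> x \<bullet> (G *v x)" and x: "x \<bullet> (G *v x) = 0"
  shows "G *v x = 0"
proof (rule ccontr)
  assume nz: "G *v x \<noteq> 0"
  define y where "y = G *v x"
  define c where "c = y \<bullet> (G *v y)"
  have ypos: "0 < y \<bullet> y"
    using nz by (simp add: y_def)
  have c: "0 \<le> c"
    unfolding c_def by (rule psd)
  have xGy: "x \<bullet> (G *v y) = y \<bullet> y"
    by (metis sym dot_lmul_matrix vector_transpose_matrix y_def)
  have quad: "0 \<le> 2 * t * (y \<bullet> y) + t\<^sup>2 * c" for t
    using psd[of "x + t *\<^sub>R y"] x xGy
    by (simp add: matrix_vector_right_distrib matrix_vector_mult_scaleR inner_add_left inner_add_right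
        y_def[symmetric] c_def power2_eq_square algebra_simps)
  \<comment> \<open>The summand 1 covers \<open>c = 0\<close>; the step is small enough for the
    linear term to outweigh the quadratic one.\<close>
  define t where "t = (y \<bullet> y) / (c + 1)"
  have "0 < t" "t * c \<le> y \<bullet> y"
    using ypos c by (simp_all add: t_def divide_simps)
  then have "t * c < 2 * (y \<bullet> y)"
    using ypos by linarith
  then have "t * (t * c) < t * (2 * (y \<bullet> y))"
    using \<open>0 < t\<close> by (rule mult_strict_left_mono)
  then show False
    using quad[of "- t"] by (simp add: power2_eq_square algebra_simps)
qed

text \<open>Compares the minimum of one form with the maximum of the other on the unit sphere and
  extends by homogeneity. It provides the room around a definite matrix for perturbations that stay
  semidefinite.\<close>

lemma definite_dominates:
  fixes G H :: "real ^ 'i ^ 'i::finite"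
  assumes pd: "\<And>x. x \<noteq> 0 \<Longrightarrow> 0 < x \<bullet> (G *v x)"
  shows "\<exists>t>0. \<forall>x. t * (x \<bullet> (H *v x)) \<le> x \<bullet> (G *v x)"
proof -
  let ?S = "sphere 0 1 :: (real ^ 'i) set"
  have cont: "continuous_on ?S (\<lambda>x. x \<bullet> (A *v x))" for A :: "real ^ 'i ^ 'i"
    by (intro continuous_intros)
  have ne: "?S \<noteq> {}"
    by simp
  obtain a where a: "a \<in> ?S" "\<And>x. x \<in> ?S \<Longrightarrow> a \<bullet> (G *v a) \<le> x \<bullet> (G *v x)"
    using continuous_attains_inf[OF compact_sphere ne cont[of G]] by blast
  obtain b where b: "b \<in> ?S" "\<And>x. x \<in> ?S \<Longrightarrow> x \<bullet> (H *v x) \<le> b \<bullet> (H *v b)"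
    using continuous_attains_sup[OF compact_sphere ne cont[of H]] by blast
  define m where "m = a \<bullet> (G *v a)"
  define C where "C = \<bar>b \<bullet> (H *v b)\<bar> + 1"
  have m: "0 < m"
    unfolding m_def by (rule pd) (use a in auto)
  have C: "0 < C"
    by (simp add: C_def)
  show ?thesis
  proof (intro exI[of _ "m / C"] conjI allI)
    show "0 < m / C"
      using m C by simp
    fix x
    show "m / C * (x \<bullet> (H *v x)) \<le> x \<bullet> (G *v x)"
    proof (cases "x = 0")
      case False
      define u where "u = x /\<^sub>R norm x"
      have u: "u \<in> ?S" and x: "x = norm x *\<^sub>R u"
        using False by (simp_all add: u_def)
      have "m / C * (u \<bullet> (H *v u)) \<le> m / C * C"
        using m C b(2)[OF u] by (intro mult_left_mono) (auto simp: C_def)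
      also have "\<dots> \<le> u \<bullet> (G *v u)"
        using C a(2)[OF u] by (simp add: m_def)
      finally have "(norm x)\<^sup>2 * (m / C * (u \<bullet> (H *v u))) \<le> (norm x)\<^sup>2 * (u \<bullet> (G *v u))"
        by (rule mult_left_mono) simp
      moreover have "x \<bullet> (A *v x) = (norm x)\<^sup>2 * (u \<bullet> (A *v u))" for A
        by (subst (1 2) x) (simp add: matrix_vector_mult_scaleR power2_eq_square)
      ultimately show ?thesis
        by (simp add: mult_ac)
    qed simp
  qed
qed

text \<open>For s constantly 1 this is the elliptope of correlation matrices. No rank condition is
  imposed, which makes the set convex.\<close>

definition elliptope :: "('i \<Rightarrow> real) \<Rightarrow> (real ^ 'i ^ 'i::finite) set" where
  "elliptope s = {G. transpose G = G \<and> (\<forall>i. G $ i $ i = s i) \<and> (\<forall>x. 0 \<le> x \<bullet> (G *v x))}"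

lemma transpose_eq_iff: "transpose G = G \<longleftrightarrow> (\<forall>i j. G $ i $ j = G $ j $ i)"
  by (auto simp: transpose_def vec_eq_iff)

lemma quadratic_form_add:
  fixes G H :: "real ^ 'i ^ 'i::finite"
  shows "x \<bullet> ((u *\<^sub>R G + v *\<^sub>R H) *v x) = u * (x \<bullet> (G *v x)) + v * (x \<bullet> (H *v x))"
  by (simp add: matrix_vector_mult_add_rdistrib inner_add_right scaleR_matrix_vector_assoc[symmetric])

lemma convex_elliptope: "convex (elliptope s)"
proof (rule convexI)
  fix G H and u v :: real
  assume *: "G \<in> elliptope s" "H \<in> elliptope s" "0 \<le> u" "0 \<le> v" "u + v = 1"
  then have "0 \<le> x \<bullet> ((u *\<^sub>R G + v *\<^sub>R H) *v x)" for x
    unfolding quadratic_form_add by (simp add: elliptope_def)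
  with * show "u *\<^sub>R G + v *\<^sub>R H \<in> elliptope s"
    by (simp add: elliptope_def transpose_eq_iff flip: distrib_right)
qed

lemma closed_elliptope: "closed (elliptope s)"
  unfolding elliptope_def transpose_eq_iff
  by (intro closed_Collect_conj closed_Collect_all closed_Collect_eq closed_Collect_le
      continuous_intros) (auto simp: matrix_vector_mult_def intro!: continuous_intros)

text \<open>Evaluating the form at the sum and the difference of two basis vectors bounds each entry
  by the diagonal.\<close>

lemma bounded_elliptope: "bounded (elliptope s)"
proof -
  define B :: "real ^ 'a ^ 'a" where "B = (\<chi> i j. \<bar>s i\<bar> + \<bar>s j\<bar>)"
  have "norm G \<le> norm B" if G: "G \<in> elliptope s" for G
  proof -
    have "\<bar>G $ i $ j\<bar> \<le> \<bar>s i\<bar> + \<bar>s j\<bar>" for i j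
    proof -
      have e: "axis i 1 \<bullet> (G *v axis j 1) = G $ i $ j" for i j
        by (simp add: matrix_vector_mult_basis column_def inner_axis' )
      have "0 \<le> (axis i 1 + c *\<^sub>R axis j 1) \<bullet> (G *v (axis i 1 + c *\<^sub>R axis j 1))" for c
        using G by (simp add: elliptope_def)
      then have "0 \<le> s i + 2 * c * G $ i $ j + c\<^sup>2 * s j" for c
        using G by (simp add: matrix_vector_right_distrib matrix_vector_mult_scaleR inner_add_left
            inner_add_right e elliptope_def transpose_eq_iff power2_eq_square algebra_simps)
      from this[of 1] this[of "- 1"] show ?thesis
        by simp
    qed
    then show ?thesis
      unfolding B_def by (intro norm_le_componentwise_cart) (simp add: norm_le_componentwise_cart)
  qed
  then show ?thesis
    by (auto simp: bounded_iff)
qed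

text \<open>The direction space of the affine hull of the elliptope when s is positive.\<close>

definition hollow_symmetric :: "(real ^ 'i ^ 'i::finite) set" where
  "hollow_symmetric = {H. transpose H = H \<and> (\<forall>i. H $ i $ i = 0)}"

lemma subspace_hollow_symmetric: "subspace hollow_symmetric"
  by (auto simp: subspace_def hollow_symmetric_def transpose_eq_iff)

text \<open>Unordered pairs of distinct indices label a basis; different pairs give matrices with
  disjoint supports, hence orthogonal ones.\<close>

lemma dim_hollow_symmetric:
  "dim (hollow_symmetric :: (real ^ 'i ^ 'i::finite) set) = CARD('i) choose 2"
proof -
  define P where "P = {S :: 'i set. card S = 2}"
  define B :: "'i set \<Rightarrow> real ^ 'i ^ 'i" where "B S = (\<chi> i j. if S = {i, j} then 1 else 0)" for S
  have B: "B S $ i $ j = (if S = {i, j} then 1 else 0)" for S i j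
    by (simp add: B_def)
  have inj: "inj_on B P"
  proof (rule inj_onI)
    fix S T
    assume "S \<in> P" "T \<in> P" and eq: "B S = B T"
    then obtain i j where S: "S = {i, j}"
      by (auto simp: P_def card_2_iff)
    have "B T $ i $ j = 1"
      using B[of S i j] S eq by simp
    then show "S = T"
      by (simp add: B S split: if_splits)
  qed
  have "B ` P \<subseteq> hollow_symmetric"
    by (auto simp: hollow_symmetric_def transpose_eq_iff B P_def insert_commute)
  moreover have "hollow_symmetric \<subseteq> span (B ` P)"
  proof
    fix H :: "real ^ 'i ^ 'i"
    assume H: "H \<in> hollow_symmetric"
    \<comment> \<open>For \<open>S = {i, j}\<close> the double sum counts the entry \<open>H $ i $ j\<close> twice.\<close>
    define c where "c S = (\<Sum>i\<in>S. \<Sum>j\<in>S. H $ i $ j) / 2" for S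
    have "(\<Sum>S\<in>P. c S * B S $ i $ j) = H $ i $ j" for i j
    proof (cases "i = j")
      case True
      then have "B S $ i $ j = 0" if "S \<in> P" for S
        using that by (auto simp: B P_def)
      then show ?thesis
        using H True by (simp add: hollow_symmetric_def)
    next
      case False
      then have "(\<Sum>S\<in>P. c S * B S $ i $ j) = (\<Sum>S\<in>{{i, j}}. c S * B S $ i $ j)"
        by (intro sum.mono_neutral_right) (auto simp: B P_def)
      also have "\<dots> = H $ i $ j"
        using H False by (simp add: B c_def hollow_symmetric_def transpose_eq_iff)
      finally show ?thesis .
    qed
    then have "H = (\<Sum>S\<in>P. c S *\<^sub>R B S)"
      by (simp add: vec_eq_iff)
    then show "H \<in> span (B ` P)"
      by (simp add: span_sum span_scale span_base)
  qed
  moreover have "independent (B ` P)"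
  proof (rule pairwise_orthogonal_independent)
    show "pairwise orthogonal (B ` P)"
      by (auto simp: pairwise_def orthogonal_def inner_vec_def B intro!: sum.neutral)
    show "0 \<notin> B ` P"
    proof
      assume "0 \<in> B ` P"
      then obtain S where "S \<in> P" and S: "B S = 0"
        by auto
      then obtain i j where "S = {i, j}"
        by (auto simp: P_def card_2_iff)
      then have "B S $ i $ j = 1"
        by (simp add: B)
      then show False
        by (simp add: S)
    qed
  qed
  moreover have "card (B ` P) = CARD('i) choose 2"
    using n_subsets[of "UNIV :: 'i set" 2] by (simp only: card_image[OF inj]) (simp add: P_def)
  ultimately show ?thesis
    by (rule dim_unique)
qed

lemma equi_gram_matrix_0_quadratic_form: "x \<bullet> (equi_gram_matrix s 0 *v x) = (\<Sum>i\<in>UNIV. s i * (x $ i)\<^sup>2)"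
proof -
  have "(equi_gram_matrix s 0 *v x) $ i = (\<Sum>j\<in>UNIV. if j = i then s i * x $ i else 0)" for i
    unfolding matrix_vector_mult_def equi_gram_matrix_def vec_lambda_beta by (intro sum.cong) auto
  then show ?thesis
    by (simp add: inner_vec_def power2_eq_square mult_ac)
qed

text \<open>For \<alpha> = 0 the matrix is diagonal. It serves as the definite reference point
  inside the elliptope.\<close>

lemma equi_gram_matrix_0_pos:
  assumes "\<And>i. 0 < s i" "x \<noteq> 0"
  shows "0 < x \<bullet> (equi_gram_matrix s 0 *v x)"
proof -
  obtain k where "x $ k \<noteq> 0"
    using assms(2) by (auto simp: vec_eq_iff)
  then show ?thesis
    unfolding equi_gram_matrix_0_quadratic_form
    using assms(1) by (intro sum_pos2[of _ k]) (auto simp: less_imp_le)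
qed

lemma equi_gram_matrix_0_elliptope:
  assumes "\<And>i. 0 < s i"
  shows "equi_gram_matrix s 0 \<in> elliptope s"
proof -
  have "0 \<le> x \<bullet> (equi_gram_matrix s 0 *v x)" for x
    using equi_gram_matrix_0_pos[where s = s and x = x, OF assms] by (cases "x = 0") auto
  then show ?thesis
    by (simp add: elliptope_def transpose_eq_iff) (simp add: equi_gram_matrix_def)
qed

text \<open>Small hollow symmetric perturbations of the definite diagonal matrix stay semidefinite,
  so the affine hull is a full translate of the space of such matrices.\<close>

lemma aff_dim_elliptope:
  fixes s :: "'i::finite \<Rightarrow> real"
  assumes s: "\<And>i. 0 < s i"
  shows "aff_dim (elliptope s) = int (CARD('i) choose 2)"
proof -
  let ?D = "equi_gram_matrix s 0"
  have D: "?D \<in> elliptope s"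
    using s by (rule equi_gram_matrix_0_elliptope)
  have "elliptope s \<subseteq> (+) ?D ` hollow_symmetric"
  proof
    fix G
    assume "G \<in> elliptope s"
    with D have "G - ?D \<in> hollow_symmetric"
      by (auto simp: elliptope_def hollow_symmetric_def transpose_eq_iff)
    then show "G \<in> (+) ?D ` hollow_symmetric"
      by (rule rev_image_eqI) simp
  qed
  moreover have "(+) ?D ` hollow_symmetric \<subseteq> affine hull (elliptope s)"
  proof clarify
    fix H :: "real ^ 'i ^ 'i"
    assume H: "H \<in> hollow_symmetric"
    obtain t where t: "0 < t" "\<forall>x. t * (x \<bullet> ((- H) *v x)) \<le> x \<bullet> (?D *v x)"
      using definite_dominates[of ?D "- H", OF equi_gram_matrix_0_pos[where s = s, OF s]] by blast
    have "x \<bullet> ((1 *\<^sub>R ?D + t *\<^sub>R H) *v x) = x \<bullet> (?D *v x) - t * (x \<bullet> ((- H) *v x))" for x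
      unfolding quadratic_form_add
      by (simp add: matrix_vector_mult_def inner_vec_def sum_negf)
    with t(2) have "0 \<le> x \<bullet> ((1 *\<^sub>R ?D + t *\<^sub>R H) *v x)" for x
      by simp
    then have "?D + t *\<^sub>R H \<in> elliptope s"
      using H D by (auto simp: elliptope_def hollow_symmetric_def transpose_eq_iff)
    \<comment> \<open>This affine combination rescales the small perturbation
      \<open>t *\<^sub>R H\<close> back to H.\<close>
    then have "(1 - 1 / t) *\<^sub>R ?D + (1 / t) *\<^sub>R (?D + t *\<^sub>R H) \<in> affine hull (elliptope s)"
      using D by (intro mem_affine[OF affine_affine_hull]) (auto intro: hull_inc)
    then show "?D + H \<in> affine hull (elliptope s)"
      using t(1) by (simp add: scaleR_add_right scaleR_diff_left)
  qed
  ultimately have "aff_dim (elliptope s) = aff_dim ((+) ?D ` hollow_symmetric)"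
    by (metis aff_dim_affine_hull aff_dim_subset antisym)
  also have "\<dots> = int (CARD('i) choose 2)"
    by (simp add: aff_dim_translation_eq aff_dim_subspace subspace_hollow_symmetric dim_hollow_symmetric)
  finally show ?thesis .
qed

text \<open>A point is relatively interior iff every segment ending there can be prolonged inside
  the set. At a singular G, prolonging the segment from the diagonal matrix makes the form negative
  on a kernel vector. A nonsingular G is definite, so by \<open>definite_dominates\<close> some
  multiple t of any H in the elliptope lies below it, and \<open>G + t *\<^sub>R (G - H)\<close> is
  semidefinite.\<close>

lemma rel_frontier_elliptope:
  fixes s :: "'i::finite \<Rightarrow> real"
  assumes s: "\<And>i. 0 < s i"
  shows "rel_frontier (elliptope s) = {G \<in> elliptope s. det G = 0}"
proof -
  let ?D = "equi_gram_matrix s 0"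
  have D: "?D \<in> elliptope s"
    using s by (rule equi_gram_matrix_0_elliptope)
  then have ne: "elliptope s \<noteq> {}"
    by blast
  note interior = convex_rel_interior_iff[OF convex_elliptope ne]
  have "G \<in> rel_interior (elliptope s) \<longleftrightarrow> det G \<noteq> 0" if G: "G \<in> elliptope s" for G
  proof
    assume int: "G \<in> rel_interior (elliptope s)"
    then obtain e where e: "1 < e" "(1 - e) *\<^sub>R ?D + e *\<^sub>R G \<in> elliptope s"
      using D interior by blast
    show "det G \<noteq> 0"
    proof
      assume "det G = 0"
      then obtain w where w: "w \<noteq> 0" "G *v w = 0"
        using det_eq_0_iff_kernel by blast
      have "0 \<le> w \<bullet> (((1 - e) *\<^sub>R ?D + e *\<^sub>R G) *v w)"
        using e(2) unfolding elliptope_def by blast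
      then have "0 \<le> (1 - e) * (w \<bullet> (?D *v w))"
        by (simp add: quadratic_form_add w)
      then show False
        using equi_gram_matrix_0_pos[where s = s, OF s w(1)] e(1) by (simp add: zero_le_mult_iff)
    qed
  next
    assume det: "det G \<noteq> 0"
    have pos: "0 < x \<bullet> (G *v x)" if "x \<noteq> 0" for x
    proof -
      have "x \<bullet> (G *v x) \<noteq> 0"
        using semidefinite_kernel[of G x] G det det_eq_0_iff_kernel that by (auto simp: elliptope_def)
      moreover have "0 \<le> x \<bullet> (G *v x)"
        using G by (simp add: elliptope_def)
      ultimately show ?thesis
        by simp
    qed
    show "G \<in> rel_interior (elliptope s)"
      unfolding interior
    proof
      fix H
      assume H: "H \<in> elliptope s"
      obtain t where t: "0 < t" "\<forall>x. t * (x \<bullet> (H *v x)) \<le> x \<bullet> (G *v x)"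
        using definite_dominates[of G H, OF pos] by blast
      have "0 \<le> x \<bullet> (((1 - (1 + t)) *\<^sub>R H + (1 + t) *\<^sub>R G) *v x)" for x
      proof -
        have "0 \<le> t * (x \<bullet> (G *v x))"
          using G t(1) by (simp add: elliptope_def)
        with spec[OF t(2), of x] show ?thesis
          unfolding quadratic_form_add by (simp add: algebra_simps)
      qed
      then have "(1 - (1 + t)) *\<^sub>R H + (1 + t) *\<^sub>R G \<in> elliptope s"
        using G H by (auto simp: elliptope_def transpose_eq_iff algebra_simps)
      then show "\<exists>e>1. (1 - e) *\<^sub>R H + e *\<^sub>R G \<in> elliptope s"
        using t(1) by (intro exI[of _ "1 + t"]) simp
    qed
  qed
  then show ?thesis
    using rel_interior_subset by (auto simp: rel_frontier_def closure_closed[OF closed_elliptope])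
qed


section \<open>Realizing definite matrices by vectors\<close>

lemma exists_orthogonal_unit:
  fixes S :: "'a::euclidean_space set"
  assumes "finite S" "card S < DIM('a)"
  obtains u where "norm u = 1" "\<And>x. x \<in> S \<Longrightarrow> u \<bullet> x = 0"
proof -
  have "dim S < DIM('a)"
    using dim_le_card'[OF assms(1)] assms(2) by linarith
  then obtain z where z: "z \<noteq> 0" "\<And>y. y \<in> span S \<Longrightarrow> orthogonal z y"
    using orthogonal_to_subspace_exists by metis
  show ?thesis
  proof (rule that[of "z /\<^sub>R norm z"])
    show "norm (z /\<^sub>R norm z) = 1"
      using z by simp
    show "(z /\<^sub>R norm z) \<bullet> x = 0" if "x \<in> S" for x
      using z(2)[of x] that by (simp add: orthogonal_def span_base)
  qed
qed

text \<open>Vectors are added one at a time, as in a Cholesky factorization. The new one is a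
  combination x of the old ones with the prescribed scalar products, plus a multiple of a unit
  vector orthogonal to them. The squared length left for that multiple is a Schur
  complement.\<close>

lemma exists_vectors_with_gram_matrix:
  fixes N :: "real ^ 'n ^ 'n::finite"
  assumes sym: "transpose N = N" and pd: "\<And>x. x \<noteq> 0 \<Longrightarrow> 0 < x \<bullet> (N *v x)"
  shows "\<exists>f :: 'n \<Rightarrow> real ^ 'n. \<forall>i j. f i \<bullet> f j = N $ i $ j"
proof -
  have Nsym: "N $ i $ j = N $ j $ i" for i j
    using sym by (simp add: transpose_eq_iff)
  have "\<exists>f :: 'n \<Rightarrow> real ^ 'n. \<forall>i\<in>A. \<forall>j\<in>A. f i \<bullet> f j = N $ i $ j" if "finite A" for A
    using that
  proof (induction A rule: finite_induct)
    case (insert k A)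
    then obtain f :: "'n \<Rightarrow> real ^ 'n" where f: "\<And>i j. i \<in> A \<Longrightarrow> j \<in> A \<Longrightarrow> f i \<bullet> f j = N $ i $ j"
      by blast
    define r where "r c = (\<chi> i. if i \<in> A then c $ i else 0)" for c :: "real ^ 'n"
    \<comment> \<open>The system for the coefficients of x lives on A only. Extending it by the
      identity off A gives an endomorphism of the whole space, so that injectivity implies
      surjectivity.\<close>
    define T where "T c = (\<chi> i. if i \<in> A then (N *v r c) $ i else c $ i)" for c
    have Nr: "(N *v r c) $ i = (\<Sum>j\<in>A. c $ j * N $ i $ j)" for c i
    proof -
      have "(N *v r c) $ i = (\<Sum>j\<in>UNIV. if j \<in> A then c $ j * N $ i $ j else 0)"
        unfolding matrix_vector_mult_def r_def vec_lambda_beta by (intro sum.cong) auto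
      then show ?thesis
        by (simp add: sum.If_cases)
    qed
    have r_inner: "r c \<bullet> z = (\<Sum>i\<in>A. c $ i * z $ i)" for c z
    proof -
      have "r c \<bullet> z = (\<Sum>j\<in>UNIV. if j \<in> A then c $ j * z $ j else 0)"
        unfolding inner_vec_def r_def vec_lambda_beta by (intro sum.cong) auto
      then show ?thesis
        by (simp add: sum.If_cases)
    qed
    have lin_r: "linear r"
      by (intro linearI) (simp_all add: r_def vec_eq_iff)
    have lin: "linear T"
      by (intro linearI) (simp_all add: T_def vec_eq_iff linear_add[OF lin_r] linear_cmul[OF lin_r]
          matrix_vector_right_distrib matrix_vector_mult_scaleR)
    have "c = 0" if "T c = 0" for c
    proof -
      have *: "(if i \<in> A then (N *v r c) $ i else c $ i) = 0" for i
        using arg_cong[OF that, of "\<lambda>z. z $ i"] unfolding T_def by (simp only: vec_lambda_beta zero_index)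
      have "r c \<bullet> (N *v r c) = 0"
        unfolding r_inner by (rule sum.neutral) (use * in \<open>metis mult_zero_right\<close>)
      then have "r c = 0"
        using pd by force
      moreover have "c $ i = 0" if "i \<notin> A" for i
        using *[of i] that by simp
      then have "r c = c"
        by (simp add: r_def vec_eq_iff)
      ultimately show ?thesis
        by simp
    qed
    then have "inj T"
      using linear_injective_0[OF lin] by blast
    then have "surj T"
      using linear_injective_imp_surjective[OF lin] by simp
    then obtain c where c: "T c = (\<chi> i. N $ i $ k)"
      by (metis surjD)
    have Nc: "(N *v r c) $ i = N $ i $ k" if "i \<in> A" for i
      using arg_cong[OF c, of "\<lambda>z. z $ i"] that by (simp add: T_def)
    define x where "x = (\<Sum>j\<in>A. c $ j *\<^sub>R f j)"
    have xf: "x \<bullet> f i = N $ i $ k" if "i \<in> A" for i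
    proof -
      have "x \<bullet> f i = (\<Sum>j\<in>A. c $ j * N $ i $ j)"
        unfolding x_def inner_sum_left by (rule sum.cong) (use f that Nsym in auto)
      then show ?thesis
        using Nr Nc that by simp
    qed
    define \<sigma> where "\<sigma> = (\<Sum>i\<in>A. c $ i * N $ i $ k)"
    have xx: "x \<bullet> x = \<sigma>"
    proof -
      have "x \<bullet> x = (\<Sum>i\<in>A. c $ i * (x \<bullet> f i))"
        by (subst (2) x_def) (simp add: inner_sum_right)
      then show ?thesis
        by (simp add: \<sigma>_def xf)
    qed
    \<comment> \<open>At this vector the form of N takes the value of the Schur complement, which is
      therefore positive.\<close>
    define y where "y = axis k 1 - r c"
    have "y $ k = 1"
      using insert.hyps by (simp add: y_def r_def)
    then have "y \<noteq> 0"
      by auto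
    moreover have "y \<bullet> (N *v y) = N $ k $ k - \<sigma>"
    proof -
      have Nk: "N *v axis k 1 = (\<chi> i. N $ i $ k)"
        by (simp add: matrix_vector_mult_basis column_def)
      have 1: "axis k 1 \<bullet> (N *v r c) = \<sigma>"
        by (simp add: inner_axis' Nr \<sigma>_def Nsym[of k])
      have 2: "r c \<bullet> (N *v axis k 1) = \<sigma>"
        by (simp add: r_inner Nk \<sigma>_def)
      have 3: "r c \<bullet> (N *v r c) = \<sigma>"
        by (simp add: r_inner Nc \<sigma>_def)
      have 4: "axis k 1 \<bullet> (N *v axis k 1) = N $ k $ k"
        by (simp add: inner_axis' Nk)
      show ?thesis
        by (simp add: y_def matrix_vector_mult_diff_distrib inner_diff_left inner_diff_right 1 2 3 4)
    qed
    ultimately have pos: "0 < N $ k $ k - \<sigma>"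
      using pd[of y] by simp
    have "A \<noteq> UNIV"
      using insert.hyps by auto
    then have "card A < CARD('n)"
      by (intro psubset_card_mono) auto
    then have "card (f ` A) < DIM(real ^ 'n)"
      using card_image_le[OF insert.hyps(1), of f] by simp
    then obtain u where u: "norm u = 1" "\<And>z. z \<in> f ` A \<Longrightarrow> u \<bullet> z = 0"
      using exists_orthogonal_unit[of "f ` A"] insert.hyps(1) by blast
    define g where "g = f(k := x + sqrt (N $ k $ k - \<sigma>) *\<^sub>R u)"
    have uf: "u \<bullet> f i = 0" if "i \<in> A" for i
      using u that by blast
    have ux: "u \<bullet> x = 0"
      by (simp add: x_def inner_sum_right uf)
    have gk: "g i \<bullet> g k = N $ i $ k" "g k \<bullet> g i = N $ k $ i" if "i \<in> A" for i
      using that insert.hyps Nsym[of k i] by (auto simp: g_def inner_add_left inner_add_right xf uf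
          inner_commute[of "f i"])
    have "u \<bullet> u = 1"
      using u(1) by (simp add: dot_square_norm)
    then have "g k \<bullet> g k = N $ k $ k"
      using pos by (simp add: g_def inner_add_left inner_add_right xx ux inner_commute[of x u])
    moreover have "g i \<bullet> g j = N $ i $ j" if "i \<in> A" "j \<in> A" for i j
      using that insert.hyps f by (auto simp: g_def)
    ultimately show ?case
      using gk by (intro exI[of _ g]) auto
  qed simp
  from this[OF finite[of UNIV]] show ?thesis
    by auto
qed

text \<open>The vector on the right runs through the hyperplane of coordinate sum 0, so the edge
  form is the restriction of G to that hyperplane.\<close>

lemma edge_gram_quadratic_form:
  fixes G :: "real ^ 'n::finite option ^ 'n option"
  shows "y \<bullet> (edge_gram G *v y)
    = (\<chi> i. case i of None \<Rightarrow> - (\<Sum>j\<in>UNIV. y $ j) | Some j \<Rightarrow> y $ j) \<bullet>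
      (G *v (\<chi> i. case i of None \<Rightarrow> - (\<Sum>j\<in>UNIV. y $ j) | Some j \<Rightarrow> y $ j))"
  by (simp add: inner_vec_def matrix_vector_mult_def sum_option edge_gram_def algebra_simps
      sum.distrib sum_subtractf sum_distrib_left sum_distrib_right sum_negf)
    (subst sum.swap, simp add: mult_ac)

section \<open>The manifold of Gram matrices\<close>

lemma gram_matrix_elliptope:
  assumes "\<And>i. q $ i \<bullet> q $ i = s i"
  shows "gram_matrix q \<in> elliptope s"
  using assms by (simp add: elliptope_def transpose_eq_iff inner_commute quadratic_form_gram)

text \<open>The edges are realized first; their scalar products with vertex \<open>None\<close> then
  determine that vertex by a linear system. Only its length remains unaccounted for, and the
  singularity of G settles it.\<close>

lemma elliptope_realizable:
  fixes G :: "real ^ 'n::finite option ^ 'n option"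
  assumes s: "\<And>i. 0 < s i" and G: "G \<in> elliptope s"
    and det: "det G = 0" "det (edge_gram G) \<noteq> 0"
  obtains q where "q \<in> config_space s" "gram_matrix q = G"
proof -
  let ?N = "edge_gram G"
  define z where "z y = (\<chi> i. case i of None \<Rightarrow> - (\<Sum>j\<in>UNIV. y $ j) | Some j \<Rightarrow> y $ j)" for y :: "real ^ 'n"
  note form = edge_gram_quadratic_form[of _ G, folded z_def]
  have sym: "G $ i $ j = G $ j $ i" and diag: "G $ i $ i = s i" and psd: "0 \<le> x \<bullet> (G *v x)" for i j x
    using G by (simp_all add: elliptope_def transpose_eq_iff)
  have Nsym: "transpose ?N = ?N"
    using sym by (simp add: transpose_eq_iff edge_gram_def)
  have Npd: "0 < y \<bullet> (?N *v y)" if "y \<noteq> 0" for y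
  proof -
    have psdN: "0 \<le> x \<bullet> (?N *v x)" for x
      unfolding form by (rule psd)
    have "y \<bullet> (?N *v y) \<noteq> 0"
      using semidefinite_kernel[OF Nsym psdN] det(2) det_eq_0_iff_kernel that by blast
    with psdN[of y] show ?thesis
      by linarith
  qed
  have "\<exists>f :: 'n \<Rightarrow> real ^ 'n. \<forall>i j. f i \<bullet> f j = ?N $ i $ j"
    by (rule exists_vectors_with_gram_matrix[OF Nsym]) (rule Npd)
  then obtain f :: "'n \<Rightarrow> real ^ 'n" where f: "\<And>i j. f i \<bullet> f j = ?N $ i $ j"
    by blast
  define F where "F = (\<chi> j. f j)"
  have "F ** transpose F = ?N"
    by (simp add: vec_eq_iff F_def matrix_matrix_mult_def transpose_def f[symmetric] inner_vec_def)
  then have "invertible F"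
    using det(2) by (metis det_mul invertible_det_nz mult_zero_left)
  then obtain x where x: "F *v x = (\<chi> j. G $ None $ Some j - G $ None $ None)"
    by (metis invertible_def matrix_vector_mul_assoc matrix_vector_mul_lid)
  have xf: "f j \<bullet> x = G $ None $ Some j - G $ None $ None" for j
    using arg_cong[OF x, of "\<lambda>v. v $ j"] by (simp add: F_def matrix_vector_mult_def inner_vec_def)
  define q :: "'n config" where "q = (\<chi> i. case i of None \<Rightarrow> x | Some j \<Rightarrow> x + f j)"
  \<comment> \<open>The Gram matrix of \<open>q\<close> is \<open>G\<close> with \<open>t\<close> added to every entry; as both are singular and semidefinite, \<open>t = 0\<close>.\<close>
  define t where "t = x \<bullet> x - G $ None $ None"
  have symN: "G $ Some j $ None = G $ None $ Some j" for j
    by (rule sym)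
  have q: "q $ i \<bullet> q $ j = G $ i $ j + t" for i j
    by (cases i; cases j) (simp_all add: q_def t_def inner_add_left inner_add_right xf f edge_gram_def
        inner_commute[of x "f _"] symN)
  have shift: "v \<bullet> (gram_matrix q *v v) = v \<bullet> (G *v v) + t * (\<Sum>i\<in>UNIV. v $ i)\<^sup>2" for v
    by (simp add: inner_vec_def[where 'b = "'n option"] matrix_vector_mult_def q algebra_simps sum.distrib
        sum_distrib_left sum_distrib_right power2_eq_square)
  have "edge_gram (gram_matrix q) = ?N"
    by (simp add: vec_eq_iff edge_gram_def q)
  then have V: "oriented_volume q \<noteq> 0"
    using det(2) by (metis det_edge_gram power_zero_numeral)
  \<comment> \<open>A kernel vector of the Gram matrix with coordinate sum 1: there
    \<open>shift\<close> turns semidefiniteness of G into \<open>t \<le> 0\<close>.\<close>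
  obtain w where w: "(\<Sum>i\<in>UNIV. w i) = 1" "(\<Sum>i\<in>UNIV. w i *\<^sub>R q $ i) = 0"
    using barycentric_origin[OF V] by blast
  have "gram_matrix q *v (\<chi> i. w i) = 0"
    by (rule gram_matrix_kernel) (simp add: w)
  then have "t \<le> 0"
    using shift[of "\<chi> i. w i"] psd[of "\<chi> i. w i"] w(1) by simp
  obtain v where v: "v \<noteq> 0" "G *v v = 0"
    using det(1) det_eq_0_iff_kernel by blast
  \<comment> \<open>Otherwise v would lie in the hyperplane on which G is definite. With a nonzero
    sum, \<open>shift\<close> at v gives the opposite sign for t.\<close>
  have "(\<Sum>i\<in>UNIV. v $ i) \<noteq> 0"
  proof
    assume "(\<Sum>i\<in>UNIV. v $ i) = 0"
    then have "v $ None = - (\<Sum>j\<in>UNIV. v $ Some j)"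
      by (simp add: sum_option)
    then have vz: "v = z (\<chi> j. v $ Some j)"
      by (simp add: z_def vec_eq_iff split: option.split)
    then have "(\<chi> j. v $ Some j) \<bullet> (?N *v (\<chi> j. v $ Some j)) = 0"
      using v(2) by (simp add: form)
    then have "(\<chi> j. v $ Some j) = 0"
      using Npd by force
    then have "z (\<chi> j. v $ Some j) = 0"
      by (simp add: z_def vec_eq_iff split: option.split)
    with vz v(1) show False
      by simp
  qed
  moreover have "0 \<le> t * (\<Sum>i\<in>UNIV. v $ i)\<^sup>2"
  proof -
    have "0 \<le> v \<bullet> (gram_matrix q *v v)"
      unfolding quadratic_form_gram by simp
    then show ?thesis
      by (simp add: shift v(2))
  qed
  ultimately have "t = 0"
    using \<open>t \<le> 0\<close> by (simp add: zero_le_mult_iff)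
  then have "gram_matrix q = G"
    by (simp add: vec_eq_iff q)
  moreover have "q \<in> config_space s"
    using V \<open>t = 0\<close> by (simp add: config_space_iff[OF less_imp_le[OF s]] q diag)
  ultimately show ?thesis
    using that by blast
qed

lemma gram_matrix_image_config_space:
  fixes s :: "'n::finite option \<Rightarrow> real"
  assumes s: "\<And>i. 0 < s i"
  shows "gram_matrix ` config_space s = {G \<in> rel_frontier (elliptope s). det (edge_gram G) \<noteq> 0}"
proof safe
  fix q
  assume q: "q \<in> config_space s"
  then show "gram_matrix q \<in> rel_frontier (elliptope s)"
    by (simp add: rel_frontier_elliptope[OF s] det_gram_matrix gram_matrix_elliptope
        config_space_iff[OF less_imp_le[OF s]])
  show False if "det (edge_gram (gram_matrix q)) = 0"
    using q that by (simp add: det_edge_gram config_space_eq)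
next
  fix G :: "real ^ 'n option ^ 'n option"
  assume "G \<in> rel_frontier (elliptope s)" "det (edge_gram G) \<noteq> 0"
  then show "G \<in> gram_matrix ` config_space s"
    using elliptope_realizable[where s = s and G = G, OF s] by (force simp: rel_frontier_elliptope[OF s])
qed

text \<open>A second coordinate leaves a zero column. This places rank-one Gram matrices outside the
  image of the configuration space.\<close>

lemma oriented_volume_parallel:
  fixes c :: "'n::finite option \<Rightarrow> real"
  assumes "2 \<le> CARD('n)"
  shows "oriented_volume (\<chi> i. c i *\<^sub>R axis k 1) = 0"
proof -
  have "UNIV \<noteq> {k}"
  proof
    assume "UNIV = {k}"
    then have "CARD('n) = card {k}"
      by (rule arg_cong)
    with assms show False
      by simp
  qed
  then obtain l where "l \<noteq> k"
    by auto
  then show ?thesis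
    unfolding oriented_volume_rows
    by (intro det_zero_column(1)[of l]) (simp add: column_def axis_def vec_eq_iff)
qed

section \<open>Euclidean charts and quotient maps\<close>

lemma homeomorphic_subspace_Euclidean_space:
  fixes T :: "'a::euclidean_space set"
  assumes "subspace T"
  shows "top_of_set T homeomorphic_space Euclidean_space (dim T)"
proof -
  obtain B where B: "pairwise orthogonal B" "\<And>x. x \<in> B \<Longrightarrow> norm x = 1" "independent B"
      "card B = dim T" "span B = T"
    using orthonormal_basis_subspace[OF assms] by metis
  have "finite B"
    using B(3) by (rule independent_imp_finite)
  then obtain b where b: "bij_betw b {..<dim T} B"
    using B(4) by (metis ex_bij_betw_nat_finite atLeast0LessThan)
  have bb: "b i \<bullet> b j = (if i = j then 1 else 0)" if "i < dim T" "j < dim T" for i j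
  proof (cases "i = j")
    case True
    then show ?thesis
      using B(2)[of "b i"] b that by (auto simp: bij_betw_def dot_square_norm)
  next
    case False
    then have "b i \<noteq> b j" "b i \<in> B" "b j \<in> B"
      using b that by (auto simp: bij_betw_def inj_on_def)
    then show ?thesis
      using B(1) False by (auto simp: pairwise_def orthogonal_def)
  qed
  define f where "f x i = (if i < dim T then x \<bullet> b i else 0)" for x i
  define g where "g y = (\<Sum>i<dim T. y i *\<^sub>R b i)" for y :: "nat \<Rightarrow> real"
  have gT: "g y \<in> T" for y
    unfolding g_def using b B(5) by (intro subspace_sum[OF assms] subspace_scale[OF assms])
      (auto simp: bij_betw_def intro: span_base)
  have "homeomorphic_maps (top_of_set T) (Euclidean_space (dim T)) f g"
    unfolding homeomorphic_maps_def
  proof (intro conjI ballI)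
    show "continuous_map (top_of_set T) (Euclidean_space (dim T)) f"
      unfolding f_def continuous_map_componentwise_Euclidean_space
      by (auto intro!: continuous_intros)
    have "continuous_map (powertop_real UNIV) euclidean g"
      unfolding g_def euclidean_product_topology
      by (auto intro!: continuous_intros)
    then show "continuous_map (Euclidean_space (dim T)) (top_of_set T) g"
      using gT by (auto simp: Euclidean_space_def continuous_map_in_subtopology intro: continuous_map_from_subtopology)
    show "g (f x) = x" if "x \<in> topspace (top_of_set T)" for x
    proof -
      have "g (f x) = (\<Sum>i<dim T. (x \<bullet> b i) *\<^sub>R b i)"
        by (simp add: g_def f_def)
      also have "\<dots> = (\<Sum>c\<in>B. (x \<bullet> c) *\<^sub>R c)"
        by (rule sum.reindex_bij_betw[OF b])
      also have "\<dots> = x"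
        using that B \<open>finite B\<close> by (intro orthonormal_basis_expand) auto
      finally show ?thesis .
    qed
    show "f (g y) = y" if "y \<in> topspace (Euclidean_space (dim T))" for y
    proof
      fix i
      show "f (g y) i = y i"
      proof (cases "i < dim T")
        case True
        then have "f (g y) i = (\<Sum>j<dim T. y j * (b j \<bullet> b i))"
          by (simp add: f_def g_def inner_sum_left)
        also have "\<dots> = (\<Sum>j<dim T. if j = i then y j else 0)"
          by (rule sum.cong) (use True in \<open>auto simp: bb\<close>)
        finally show ?thesis
          using True by simp
      next
        case False
        then show ?thesis
          using that by (simp add: f_def topspace_Euclidean_space)
      qed
    qed
  qed
  then show ?thesis
    by (auto simp: homeomorphic_space_def)
qed

text \<open>A closed part of the configuration space is the trace of a compact subset of
  \<open>sphere_product s\<close>, whose image is closed. The image of the trace is the trace of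
  that image because the Gram matrix determines whether the volume vanishes. C is taken to be either
  the whole space or one component.\<close>

lemma quotient_map_gram_matrix:
  assumes C: "closedin (top_of_set (config_space s)) C"
    and image: "gram_matrix ` C = gram_matrix ` config_space s"
  shows "quotient_map (top_of_set C) (top_of_set (gram_matrix ` config_space s)) gram_matrix"
proof (rule continuous_closed_imp_quotient_map)
  have CX: "C \<subseteq> config_space s"
    using closedin_subset[OF C] by simp
  show "continuous_map (top_of_set C) (top_of_set (gram_matrix ` config_space s)) gram_matrix"
    using CX by (auto simp: continuous_map_in_subtopology continuous_on_gram_matrix)
  show "closed_map (top_of_set C) (top_of_set (gram_matrix ` config_space s)) gram_matrix"
    unfolding closed_map_def
  proof (intro allI impI)
    fix D
    assume "closedin (top_of_set C) D"
    with C have "closedin (top_of_set (config_space s)) D"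
      by (rule closedin_trans[rotated])
    then obtain T where T: "closed T" "D = config_space s \<inter> T"
      by (auto simp: closedin_closed)
    have "compact (sphere_product s \<inter> T)"
      using compact_sphere_product T(1) by (rule compact_Int_closed)
    then have "closed (gram_matrix ` (sphere_product s \<inter> T))"
      by (intro compact_imp_closed compact_continuous_image continuous_on_gram_matrix)
    moreover have "gram_matrix ` D = gram_matrix ` config_space s \<inter> gram_matrix ` (sphere_product s \<inter> T)"
    proof
      show "gram_matrix ` D \<subseteq> gram_matrix ` config_space s \<inter> gram_matrix ` (sphere_product s \<inter> T)"
        by (auto simp: T(2) config_space_eq)
      show "gram_matrix ` config_space s \<inter> gram_matrix ` (sphere_product s \<inter> T) \<subseteq> gram_matrix ` D"
      proof
        fix G
        assume "G \<in> gram_matrix ` config_space s \<inter> gram_matrix ` (sphere_product s \<inter> T)"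
        then obtain q q' where G: "G = gram_matrix q'" and q: "q \<in> config_space s"
            "gram_matrix q = gram_matrix q'" "q' \<in> sphere_product s" "q' \<in> T"
          by auto
        have "(oriented_volume q')\<^sup>2 = (oriented_volume q)\<^sup>2"
          by (simp flip: det_edge_gram add: q(2))
        with q have "q' \<in> D"
          by (auto simp: T(2) config_space_eq)
        then show "G \<in> gram_matrix ` D"
          by (simp add: G)
      qed
    qed
    ultimately show "closedin (top_of_set (gram_matrix ` config_space s)) (gram_matrix ` D)"
      by (auto simp: closedin_closed)
  qed
  show "gram_matrix ` topspace (top_of_set C) = topspace (top_of_set (gram_matrix ` config_space s))"
    using image by simp
qed

text \<open>Quotient maps with the same fibres have homeomorphic targets. The formula for g is
  retained so that the final homeomorphism can be identified as the natural one.\<close>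

lemma homeomorphic_map_of_quotient_maps:
  assumes f: "quotient_map X Y f" and h: "quotient_map X Z h"
    and eq: "\<And>x y. x \<in> topspace X \<Longrightarrow> y \<in> topspace X \<Longrightarrow> f x = f y \<longleftrightarrow> h x = h y"
  shows "\<exists>g. homeomorphic_map Y Z g \<and> (\<forall>x\<in>topspace X. g (f x) = h x)"
proof -
  obtain g where g: "continuous_map Y Z g" "\<And>x. x \<in> topspace X \<Longrightarrow> g (f x) = h x"
    using quotient_map_lift_exists[OF f quotient_imp_continuous_map[OF h]] eq by metis
  have "quotient_map X Z (g \<circ> f)"
    using h by (rule quotient_map_eq) (simp add: g)
  then have "quotient_map Y Z g"
    using f quotient_map_compose_eq by blast
  moreover have "inj_on g (topspace Y)"
  proof (rule inj_onI)
    fix u v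
    assume "u \<in> topspace Y" "v \<in> topspace Y" and guv: "g u = g v"
    then obtain x y where "x \<in> topspace X" "y \<in> topspace X" "u = f x" "v = f y"
      using quotient_imp_surjective_map[OF f] by blast
    then show "u = v"
      using guv eq g(2) by metis
  qed
  ultimately show ?thesis
    using g(2) by (auto simp: homeomorphic_map_def)
qed

lemma second_countable_euclidean:
  "second_countable (euclidean :: 'a::second_countable_topology topology)"
proof -
  obtain \<B> :: "'a set set" where \<B>: "countable \<B>" "\<And>C. C \<in> \<B> \<Longrightarrow> open C"
      "\<And>S. open S \<Longrightarrow> \<exists>U. U \<subseteq> \<B> \<and> S = \<Union>U"
    by (rule univ_second_countable) blast
  then have "\<exists>V\<in>\<B>. x \<in> V \<and> V \<subseteq> S" if "open S" "x \<in> S" for S x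
    using that by (metis UnionE Union_upper subsetD)
  with \<B> show ?thesis
    unfolding second_countable_def by (intro exI[of _ \<B>]) simp
qed

lemma manifold_of_dim_homeomorphic_open_Euclidean:
  assumes "X homeomorphic_space subtopology (Euclidean_space n) V" "openin (Euclidean_space n) V"
  shows "manifold_of_dim n X"
proof -
  have "second_countable (powertop_real (UNIV :: nat set))"
    by (simp add: euclidean_product_topology second_countable_euclidean)
  then have "second_countable (subtopology (Euclidean_space n) V)"
    by (simp add: Euclidean_space_def second_countable_subtopology)
  then have "second_countable X"
    using assms(1) homeomorphic_space_second_countability by blast
  moreover have "Hausdorff_space X"
    using assms(1) homeomorphic_Hausdorff_space Hausdorff_space_subtopology Hausdorff_Euclidean_space by blast
  moreover have "\<exists>U V. openin X U \<and> x \<in> U \<and> openin (Euclidean_space n) V \<and>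
       subtopology X U homeomorphic_space subtopology (Euclidean_space n) V" if "x \<in> topspace X" for x
    by (rule exI[of _ "topspace X"], rule exI[of _ V]) (use that assms in simp)
  ultimately show ?thesis
    by (simp add: manifold_of_dim_def)
qed


lemma homeomorphic_imp_homeomorphic_space:
  assumes "S homeomorphic T"
  shows "top_of_set S homeomorphic_space top_of_set T"
proof -
  obtain f g where "homeomorphism S T f g"
    using assms by (auto simp: homeomorphic_def)
  then have "homeomorphic_maps (top_of_set S) (top_of_set T) f g"
    by (auto simp: homeomorphism_def homeomorphic_maps_def)
  then show ?thesis
    by (auto simp: homeomorphic_space_def)
qed

text \<open>The puncture \<open>a\<close> comes from collinear vectors and has volume 0, so it costs
  no point of the image; within the punctured boundary, the image is cut out by an open
  condition.\<close>

lemma gram_matrix_config_space_embedding: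
  fixes s :: "'n::finite option \<Rightarrow> real"
  assumes dim: "2 \<le> CARD('n)" and s: "\<And>i. 0 < s i"
  obtains V where "openin (Euclidean_space ((CARD('n) + 1 choose 2) - 1)) V"
    "top_of_set (gram_matrix ` config_space s) homeomorphic_space
      subtopology (Euclidean_space ((CARD('n) + 1 choose 2) - 1)) V"
proof -
  define m where "m = (CARD('n) + 1 choose 2) - 1"
  \<comment> \<open>Positivity makes the truncated subtraction in m exact.\<close>
  have "0 < (CARD('n) + 1 choose 2)"
    using dim by (simp add: zero_less_binomial)
  then have m: "(CARD('n) + 1 choose 2) = m + 1"
    by (simp add: m_def)
  let ?E = "elliptope s" and ?M = "gram_matrix ` config_space s"
  fix k :: 'n
  define a where "a = gram_matrix (\<chi> i. sqrt (s i) *\<^sub>R axis k 1)"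
  have "a \<in> ?E"
    unfolding a_def by (rule gram_matrix_elliptope) (simp add: less_imp_le[OF s] inner_axis_axis)
  then have a: "a \<in> rel_frontier ?E"
    by (simp add: rel_frontier_elliptope[OF s] a_def det_gram_matrix)
  have aV: "det (edge_gram a) = 0"
    by (simp add: a_def det_edge_gram oriented_volume_parallel[OF dim])
  \<comment> \<open>Any m-dimensional subspace can serve as the model; the ambient space has room,
    since hollow symmetric matrices alone have dimension m + 1.\<close>
  have "m \<le> dim (UNIV :: (real ^ 'n option ^ 'n option) set)"
    using dim_subset_UNIV[of "hollow_symmetric :: (real ^ 'n option ^ 'n option) set"] m
    by (simp add: dim_hollow_symmetric)
  then obtain T :: "(real ^ 'n option ^ 'n option) set" where T: "subspace T" "dim T = m"
    using choose_subspace_of_subspace[of m UNIV] by blast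
  have "aff_dim ?E = aff_dim T + 1"
    using m by (simp add: aff_dim_elliptope[OF s] aff_dim_subspace T)
  then have "rel_frontier ?E - {a} homeomorphic T"
    by (intro homeomorphic_punctured_sphere_affine_gen convex_elliptope bounded_elliptope a
        subspace_imp_affine T)
  then have "top_of_set (rel_frontier ?E - {a}) homeomorphic_space top_of_set T"
    by (rule homeomorphic_imp_homeomorphic_space)
  then have "top_of_set (rel_frontier ?E - {a}) homeomorphic_space Euclidean_space m"
    using homeomorphic_subspace_Euclidean_space[OF T(1)] T(2) homeomorphic_space_trans by metis
  then obtain h where h: "homeomorphic_map (top_of_set (rel_frontier ?E - {a})) (Euclidean_space m) h"
    by (auto simp: homeomorphic_space)
  have M: "?M = {G \<in> rel_frontier ?E - {a}. det (edge_gram G) \<noteq> 0}"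
    unfolding gram_matrix_image_config_space[OF s] using aV by auto
  have sub: "?M \<subseteq> rel_frontier ?E - {a}"
    unfolding M by blast
  have "open {G :: real ^ 'n option ^ 'n option. det (edge_gram G) \<noteq> 0}"
    by (intro open_Collect_neq continuous_on_det_edge_gram continuous_on_const)
  then have opM: "openin (top_of_set (rel_frontier ?E - {a})) ?M"
    unfolding M openin_open by blast
  then have "openin (Euclidean_space m) (h ` ?M)"
    using h homeomorphic_map_openness_eq by blast
  moreover have "homeomorphic_map (subtopology (top_of_set (rel_frontier ?E - {a})) ?M)
      (subtopology (Euclidean_space m) (h ` ?M)) h"
  proof (rule homeomorphic_map_subtopologies[OF h])
    have "?M \<subseteq> topspace (top_of_set (rel_frontier ?E - {a}))"
      using M by auto
    moreover from this have "h ` ?M \<subseteq> topspace (Euclidean_space m)"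
      using homeomorphic_imp_surjective_map[OF h] by blast
    ultimately show "h ` (topspace (top_of_set (rel_frontier ?E - {a})) \<inter> ?M) = topspace (Euclidean_space m) \<inter> h ` ?M"
      by blast
  qed
  then have "top_of_set ?M homeomorphic_space subtopology (Euclidean_space m) (h ` ?M)"
    unfolding subtopology_subtopology Int_absorb1[OF sub]
    by (rule homeomorphic_map_imp_homeomorphic_space)
  ultimately show ?thesis
    using that by (simp add: m_def)
qed

section \<open>Orbit spaces\<close>

lemma orbit_orthogonal_action:
  assumes sub: "G \<subseteq> orthogonal_group" and mult: "\<And>A B. A \<in> G \<Longrightarrow> B \<in> G \<Longrightarrow> A ** B \<in> G"
    and transpose: "\<And>A. A \<in> G \<Longrightarrow> transpose A \<in> G" and A: "A \<in> G"
  shows "orbit G (\<chi> i. A *v q $ i) = orbit G q"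
proof
  show "orbit G (\<chi> i. A *v q $ i) \<subseteq> orbit G q"
    using mult A by (auto simp: orbit_def matrix_vector_mul_assoc)
  show "orbit G q \<subseteq> orbit G (\<chi> i. A *v q $ i)"
  proof
    fix r
    assume "r \<in> orbit G q"
    then obtain B where B: "B \<in> G" "r = (\<chi> i. B *v q $ i)"
      by (auto simp: orbit_def)
    have "transpose A ** A = mat 1"
      using sub A by (auto simp: orthogonal_group_def orthogonal_matrix)
    then have "r = (\<chi> i. (B ** transpose A) *v (A *v q $ i))"
      by (simp add: B matrix_vector_mul_assoc matrix_mul_assoc[symmetric])
    then show "r \<in> orbit G (\<chi> i. A *v q $ i)"
      using mult[OF B(1) transpose[OF A]] by (auto simp: orbit_def)
  qed
qed

lemma orbit_special_orthogonal_action: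
  "rotation_matrix A \<Longrightarrow> orbit special_orthogonal_group (\<chi> i. A *v q $ i) = orbit special_orthogonal_group q"
  by (rule orbit_orthogonal_action)
    (auto simp: special_orthogonal_group_def orthogonal_group_def rotation_matrix_def
      orthogonal_matrix_mul det_mul)

lemma orbit_orthogonal_group_action:
  "orthogonal_matrix A \<Longrightarrow> orbit orthogonal_group (\<chi> i. A *v q $ i) = orbit orthogonal_group q"
  by (rule orbit_orthogonal_action) (auto simp: orthogonal_group_def orthogonal_matrix_mul)

lemma orbit_self: "mat 1 \<in> G \<Longrightarrow> q \<in> orbit G q"
  by (auto simp: orbit_def intro!: image_eqI[of _ _ "mat 1"])

lemma mat_1_orthogonal [simp]:
  "mat 1 \<in> orthogonal_group" "mat 1 \<in> special_orthogonal_group"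
  by (simp_all add: orthogonal_group_def special_orthogonal_group_def rotation_matrix_def orthogonal_matrix_id)

lemma gram_matrix_orbit:
  "r \<in> orbit special_orthogonal_group q \<Longrightarrow> gram_matrix r = gram_matrix q"
  "r \<in> orbit orthogonal_group q \<Longrightarrow> gram_matrix r = gram_matrix q"
  by (auto simp: orbit_def special_orthogonal_group_def orthogonal_group_def rotation_matrix_def
      gram_matrix_orthogonal)

lemma orbit_orthogonal_group_eq_iff:
  assumes "oriented_volume q \<noteq> 0"
  shows "orbit orthogonal_group q = orbit orthogonal_group q' \<longleftrightarrow> gram_matrix q = gram_matrix q'"
proof
  assume "orbit orthogonal_group q = orbit orthogonal_group q'"
  then have "q \<in> orbit orthogonal_group q'"
    using orbit_self[of orthogonal_group q] by simp
  then show "gram_matrix q = gram_matrix q'"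
    by (rule gram_matrix_orbit)
next
  assume "gram_matrix q = gram_matrix q'"
  then obtain A where "orthogonal_matrix A" "q' = (\<chi> i. A *v q $ i)"
    using gram_matrix_eq_imp_orthogonal[OF assms] by blast
  then show "orbit orthogonal_group q = orbit orthogonal_group q'"
    by (simp add: orbit_orthogonal_group_action)
qed

text \<open>Within one component the volumes have equal sign, so there the SO(d)-orbits are the Gram
  fibres, just as the O(d)-orbits are on the whole space.\<close>

lemma orbit_special_orthogonal_group_eq_iff:
  assumes "0 < oriented_volume q * oriented_volume q'"
  shows "orbit special_orthogonal_group q = orbit special_orthogonal_group q' \<longleftrightarrow> gram_matrix q = gram_matrix q'"
proof
  assume "orbit special_orthogonal_group q = orbit special_orthogonal_group q'"
  then have "q \<in> orbit special_orthogonal_group q'"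
    using orbit_self[of special_orthogonal_group q] by simp
  then show "gram_matrix q = gram_matrix q'"
    by (rule gram_matrix_orbit)
next
  assume "gram_matrix q = gram_matrix q'"
  then obtain A where "rotation_matrix A" "q' = (\<chi> i. A *v q $ i)"
    using rotation_of_gram_matrix_eq assms by blast
  then show "orbit special_orthogonal_group q = orbit special_orthogonal_group q'"
    by (simp add: orbit_special_orthogonal_action)
qed

text \<open>Either q or its mirror image has volume of the same sign as p, and both have the same
  Gram matrix.\<close>

lemma gram_matrix_image_component:
  fixes p :: "'n::finite config"
  assumes dim: "2 \<le> CARD('n)" and s: "\<And>i. 0 < s i" and p: "p \<in> config_space s"
  shows "gram_matrix ` connected_component_set (config_space s) p = gram_matrix ` config_space s"
proof
  show "gram_matrix ` connected_component_set (config_space s) p \<subseteq> gram_matrix ` config_space s"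
    by (intro image_mono connected_component_subset)
  show "gram_matrix ` config_space s \<subseteq> gram_matrix ` connected_component_set (config_space s) p"
  proof clarify
    fix q
    assume q: "q \<in> config_space s"
    fix k :: 'n
    let ?H = "householder (axis k 1 :: real ^ 'n)"
    have H: "orthogonal_matrix ?H" "det ?H = - 1"
      by (simp_all add: orthogonal_householder det_householder[OF dim])
    let ?q = "\<chi> i. ?H *v q $ i"
    have q': "?q \<in> config_space s"
      using H(1) q by (rule orthogonal_config_space)
    have "oriented_volume p \<noteq> 0" "oriented_volume q \<noteq> 0"
      using p q by (simp_all add: config_space_eq)
    then consider "0 < oriented_volume p * oriented_volume q" | "0 < oriented_volume p * oriented_volume ?q"
      by (auto simp: oriented_volume_matrix_mult H zero_less_mult_iff mult_less_0_iff linorder_neq_iff)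
    then show "gram_matrix q \<in> gram_matrix ` connected_component_set (config_space s) p"
    proof cases
      case 1
      then show ?thesis
        using connected_component_config_space[where s = s, OF dim s p q] by blast
    next
      case 2
      then have "?q \<in> connected_component_set (config_space s) p"
        using connected_component_config_space[where s = s, OF dim s p q'] by blast
      then show ?thesis
        by (rule rev_image_eqI) (simp add: gram_matrix_orthogonal[OF H(1)])
    qed
  qed
qed

theorem theorem1:
  fixes p :: "'n::{finite,linorder} config" and s :: "'n option \<Rightarrow> real"
  assumes dim: "CARD('n) \<ge> 2"
    and framework: "diamond_framework p"
    and s: "s = sq_length p"
    and labelling: "0 < s None" "mono s"
  shows "manifold_of_dim (((CARD('n) + 1) choose 2) - 1) (deformation_space p) \<and>
    (\<exists>f. homeomorphic_map (deformation_space p) (orbit_space orthogonal_group (config_space s)) f \<and>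
         (\<forall>q\<in>component_of_framework p.
            f (orbit special_orthogonal_group q) = orbit orthogonal_group q)) \<and>
    (\<exists>!\<alpha>. \<alpha> < 0 \<and> det (equi_gram_matrix s \<alpha>) = 0) \<and>
    (\<forall>\<alpha>. \<alpha> < 0 \<and> det (equi_gram_matrix s \<alpha>) = 0 \<longrightarrow>
      (\<exists>C\<in>topspace (deformation_space p).
         (\<forall>D\<in>topspace (deformation_space p).
            D = C \<longleftrightarrow> (\<forall>q\<in>D. \<forall>i j. i \<noteq> j \<longrightarrow> q $ i \<bullet> q $ j = \<alpha>)) \<and>
         (\<forall>q\<in>C. \<forall>D\<in>topspace (deformation_space p). \<forall>q'\<in>D.
            (oriented_volume q')\<^sup>2 \<le> (oriented_volume q)\<^sup>2)))"
proof -
  let ?X = "config_space s" and ?SO = "special_orthogonal_group :: ((real, 'n) vec, 'n) vec set"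
    and ?O = "orthogonal_group :: ((real, 'n) vec, 'n) vec set"
  let ?M = "gram_matrix ` ?X"
  have pos: "0 < s i" for i
    using framework by (simp add: diamond_framework_def s sq_length_def)
  have X: "q \<in> ?X \<longleftrightarrow> (\<forall>i. q $ i \<bullet> q $ i = s i) \<and> oriented_volume q \<noteq> 0" for q
    by (rule config_space_iff) (rule less_imp_le[OF pos])
  have pX: "p \<in> ?X"
    using framework unfolding X by (simp add: diamond_framework_def s sq_length_def)
  define K where "K = component_of_framework p"
  have K: "K = connected_component_set ?X p"
    by (simp add: K_def component_of_framework_def s)
  have KX: "K \<subseteq> ?X"
    unfolding K by (rule connected_component_subset)
  have deformation: "deformation_space p = orbit_space ?SO K"
    by (simp add: deformation_space_def K_def)
  have sign: "0 < oriented_volume q * oriented_volume q'" if "q \<in> K" "q' \<in> K" for q q'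
    using that connected_component_volume_sign[of s p q] connected_component_volume_sign[of s p q']
    by (auto simp: K zero_less_mult_iff)
  have quotient_K: "quotient_map (top_of_set K) (top_of_set ?M) gram_matrix"
    unfolding K by (intro quotient_map_gram_matrix closedin_connected_component
        gram_matrix_image_component[where s = s, OF dim pos pX])
  have quotient_X: "quotient_map (top_of_set ?X) (top_of_set ?M) gram_matrix"
    by (rule quotient_map_gram_matrix) auto
  have "\<exists>g. homeomorphic_map (orbit_space ?SO K) (top_of_set ?M) g \<and>
      (\<forall>q\<in>topspace (top_of_set K). g (orbit ?SO q) = gram_matrix q)"
    by (rule homeomorphic_map_of_quotient_maps[OF quotient_map_orbit_space quotient_K])
      (simp add: orbit_special_orthogonal_group_eq_iff sign)
  then obtain g where g: "homeomorphic_map (deformation_space p) (top_of_set ?M) g"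
    "\<And>q. q \<in> K \<Longrightarrow> g (orbit ?SO q) = gram_matrix q"
    by (auto simp: deformation)
  have "\<exists>h. homeomorphic_map (top_of_set ?M) (orbit_space ?O ?X) h \<and>
      (\<forall>q\<in>topspace (top_of_set ?X). h (gram_matrix q) = orbit ?O q)"
    by (rule homeomorphic_map_of_quotient_maps[OF quotient_X quotient_map_orbit_space])
      (simp add: orbit_orthogonal_group_eq_iff X)
  then obtain h where h: "homeomorphic_map (top_of_set ?M) (orbit_space ?O ?X) h"
    "\<And>q. q \<in> ?X \<Longrightarrow> h (gram_matrix q) = orbit ?O q"
    by auto
  \<comment> \<open>Both orbit spaces are identified with the set of Gram matrices, so the composite
    sends the SO(d)-orbit of q to its O(d)-orbit.\<close>
  have homeomorphism: "\<exists>f. homeomorphic_map (deformation_space p) (orbit_space ?O ?X) f \<and>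
      (\<forall>q\<in>component_of_framework p. f (orbit ?SO q) = orbit ?O q)"
    using homeomorphic_map_compose[OF g(1) h(1)] g(2) h(2) KX
    by (intro exI[of _ "h \<circ> g"]) (auto simp: K_def[symmetric])
  obtain V where "openin (Euclidean_space ((CARD('n) + 1 choose 2) - 1)) V"
    "top_of_set ?M homeomorphic_space subtopology (Euclidean_space ((CARD('n) + 1 choose 2) - 1)) V"
    using gram_matrix_config_space_embedding[where s = s, OF dim pos] by blast
  then have manifold: "manifold_of_dim (((CARD('n) + 1) choose 2) - 1) (deformation_space p)"
    using manifold_of_dim_homeomorphic_open_Euclidean homeomorphic_space_trans
      homeomorphic_map_imp_homeomorphic_space[OF g(1)] by blast
  \<comment> \<open>The maximizer e has two uses: its common scalar product is the negative root,
    and its orbit is the point where the maximum is attained.\<close>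
  obtain e \<beta> where e: "connected_component ?X p e" and \<beta>: "\<beta> < 0" "gram_matrix e = equi_gram_matrix s \<beta>"
    and max: "\<And>q'. connected_component ?X p q' \<Longrightarrow> (oriented_volume q')\<^sup>2 \<le> (oriented_volume e)\<^sup>2"
    using equiangular_in_component[where s = s, OF dim pos pX] by blast
  have root: "det (equi_gram_matrix s \<beta>) = 0"
    using \<beta>(2) by (rule det_gram_equi_root)
  have unique: "\<alpha> = \<beta>" if "\<alpha> < 0" "det (equi_gram_matrix s \<alpha>) = 0" for \<alpha>
    using negative_root_unique[where s = s, OF pos that \<beta>(1) root] .
  have eK: "e \<in> K"
    using e by (simp add: K)
  have volume_orbit: "(oriented_volume r)\<^sup>2 = (oriented_volume q)\<^sup>2" if "r \<in> orbit ?SO q" for r q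
    using gram_matrix_orbit(1)[OF that] by (simp flip: det_edge_gram)
  have equiangular: "orbit ?SO q = orbit ?SO e \<longleftrightarrow> (\<forall>r\<in>orbit ?SO q. \<forall>i j. i \<noteq> j \<longrightarrow> r $ i \<bullet> r $ j = \<beta>)"
    if q: "q \<in> K" for q
  proof
    assume eq: "orbit ?SO q = orbit ?SO e"
    show "\<forall>r\<in>orbit ?SO q. \<forall>i j. i \<noteq> j \<longrightarrow> r $ i \<bullet> r $ j = \<beta>"
    proof (intro ballI allI impI)
      fix r and i j :: "'n option"
      assume "r \<in> orbit ?SO q" "i \<noteq> j"
      then have "gram_matrix r = equi_gram_matrix s \<beta>"
        using gram_matrix_orbit(1)[of r e] eq \<beta>(2) by simp
      then have "gram_matrix r $ i $ j = equi_gram_matrix s \<beta> $ i $ j"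
        by simp
      with \<open>i \<noteq> j\<close> show "r $ i \<bullet> r $ j = \<beta>"
        by (simp add: equi_gram_matrix_def)
    qed
  next
    assume "\<forall>r\<in>orbit ?SO q. \<forall>i j. i \<noteq> j \<longrightarrow> r $ i \<bullet> r $ j = \<beta>"
    then have "q $ i \<bullet> q $ j = \<beta>" if "i \<noteq> j" for i j
      using that orbit_self[of ?SO q] by simp
    moreover have "q $ i \<bullet> q $ i = s i" for i
      using q KX X by blast
    ultimately have "gram_matrix q = gram_matrix e"
      unfolding \<beta>(2) by (intro equi_gram_gram_matrix) auto
    then show "orbit ?SO q = orbit ?SO e"
      using orbit_special_orthogonal_group_eq_iff[OF sign[OF q eK]] by blast
  qed
  have maximum: "\<exists>C\<in>topspace (deformation_space p).
      (\<forall>D\<in>topspace (deformation_space p).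
         D = C \<longleftrightarrow> (\<forall>q\<in>D. \<forall>i j. i \<noteq> j \<longrightarrow> q $ i \<bullet> q $ j = \<alpha>)) \<and>
      (\<forall>q\<in>C. \<forall>D\<in>topspace (deformation_space p). \<forall>q'\<in>D.
         (oriented_volume q')\<^sup>2 \<le> (oriented_volume q)\<^sup>2)"
    if "\<alpha> < 0 \<and> det (equi_gram_matrix s \<alpha>) = 0" for \<alpha>
  proof (intro bexI conjI ballI)
    show "orbit ?SO e \<in> topspace (deformation_space p)"
      using eK by (simp add: deformation)
    show "D = orbit ?SO e \<longleftrightarrow> (\<forall>q\<in>D. \<forall>i j. i \<noteq> j \<longrightarrow> q $ i \<bullet> q $ j = \<alpha>)"
      if "D \<in> topspace (deformation_space p)" for D
    proof -
      obtain q where "q \<in> K" "D = orbit ?SO q"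
        using \<open>D \<in> topspace (deformation_space p)\<close> by (auto simp: deformation)
      moreover have "\<alpha> = \<beta>"
        using unique \<open>\<alpha> < 0 \<and> det (equi_gram_matrix s \<alpha>) = 0\<close> by blast
      ultimately show ?thesis
        using equiangular[of q] by (simp only:)
    qed
    show "(oriented_volume q')\<^sup>2 \<le> (oriented_volume q)\<^sup>2"
      if "q \<in> orbit ?SO e" "D \<in> topspace (deformation_space p)" "q' \<in> D" for q D q'
    proof -
      obtain r where r: "r \<in> K" "D = orbit ?SO r"
        using \<open>D \<in> topspace (deformation_space p)\<close> by (auto simp: deformation)
      have "(oriented_volume q')\<^sup>2 = (oriented_volume r)\<^sup>2"
        using volume_orbit \<open>q' \<in> D\<close> r(2) by blast
      also have "\<dots> \<le> (oriented_volume e)\<^sup>2"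
        using r(1) max by (simp add: K)
      also have "\<dots> = (oriented_volume q)\<^sup>2"
        using volume_orbit[OF \<open>q \<in> orbit ?SO e\<close>] by simp
      finally show ?thesis .
    qed
  qed
  have "\<exists>!\<alpha>. \<alpha> < 0 \<and> det (equi_gram_matrix s \<alpha>) = 0"
    by (rule ex1I[of _ \<beta>]) (use \<beta>(1) root unique in blast)+
  with manifold homeomorphism maximum show ?thesis
    by (intro conjI allI impI)
qed

end
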